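(* Let $p$ be a prime, let $G$ be a finite $p$-group with $m=\log_p(|G|)$, let $R$ be a commutative ring, let $M$ be an $RG$-module and let $N$ be an $RG$-submodule of $M$ with $\operatorname{Ann}_N(p)=\{0\}$. Let $n\ge1$, $\rho\in Z^n(G,M)$ and $\eta\in Z^{n+1}(G,N)$. (1) There is a (not necessarily unique) $n$-cochain $\sigma\in C^n(G,N)$ such that $\Delta(\sigma)=p^m\eta$. (2) For every $r\ge m$ and every choice of $\sigma$ in (1), the cochain $\operatorname{pro}_r(\rho+p^{r-m}\sigma)$ lies in $Z^n(G,M/p^rN)$. (3) For every $r\ge 2m$ and every choice of $\sigma$ in (1), the cohomology class \[ \operatorname{pro}_r(\rho+p^{r-m}\sigma)+B^n(G,M/p^rN)\in H^n(G,M/p^rN) \] is the unique class corresponding, via the isomorphism $\Phi\colon H^n(G,M/p^rN)\to H^n(G,M)\oplus H^{n+1}(G,N)$ described in the context, to \[ \bigl(\rho+B^n(G,M),\ \eta+B^{n+1}(G,N)\bigr)\in H^n(G,M)\oplus H^{n+1}(G,N). \]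
   Context: Cochains are normalized: $C^n(G,M)$ is the set of maps $f\colon G^n\to M$ with $f(g_1,\dots,g_n)=0$ whenever some $g_i=1$. The coboundary $\Delta\colon C^n(G,M)\to C^{n+1}(G,M)$ is $\Delta f(g_1,\dots,g_{n+1})={}^{g_1}f(g_2,\dots,g_{n+1})+\sum_{i=1}^n(-1)^if(g_1,\dots,g_ig_{i+1},\dots,g_{n+1})+(-1)^{n+1}f(g_1,\dots,g_n)$; $Z^n=\ker\Delta$, $B^n=\operatorname{Im}\Delta$, $H^n=Z^n/B^n$. Cochains with values in $N$ are also regarded as cochains with values in $M$. The map $\operatorname{pro}_r$ denotes the projection $M\to M/p^rN$ and the induced maps on cochains and on cohomology. The isomorphism $\Phi$ (for $n\ge1$, $r\ge2m$): its component $H^n(G,M/p^rN)\to H^{n+1}(G,N)$ is the connecting homomorphism of the short exact sequence $0\to N\xrightarrow{x\mapsto p^rx}M\xrightarrow{\operatorname{pro}_r}M/p^rN\to0$. Its component $H^n(G,M/p^rN)\to H^n(G,M)$ is $(\operatorname{pro}_{r-m})^{-1}\circ\pi_*$, where $\pi\colon M/p^rN\to M/p^{r-m}N$ is the projection; here $\operatorname{pro}_{r-m}\colon H^n(G,M)\to H^n(G,M/p^{r-m}N)$ is injective and its image contains the image of $\pi_*$. For these $n,r$ the map $\Phi$ is an isomorphism. *)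

theory Defs
  imports "HOL-Algebra.Algebra" "HOL-Computational_Algebra.Primes"
begin

text \<open>
  An \<open>RG\<close>-module is an \<open>R\<close>-module together with an action of \<open>G\<close> by \<open>R\<close>-linear maps;
  \<open>act g x\<close> is the element written ${}^g x$.
\<close>

locale RG_module = G?: group G + module R M
  for G (structure) and R (structure) and M (structure) and act +
  assumes act_closed: "\<lbrakk>g \<in> carrier G; x \<in> carrier M\<rbrakk> \<Longrightarrow> act g x \<in> carrier M"
    and act_one: "x \<in> carrier M \<Longrightarrow> act \<one>\<^bsub>G\<^esub> x = x"
    and act_mult: "\<lbrakk>g \<in> carrier G; h \<in> carrier G; x \<in> carrier M\<rbrakk>
      \<Longrightarrow> act (g \<otimes>\<^bsub>G\<^esub> h) x = act g (act h x)"
    and act_add: "\<lbrakk>g \<in> carrier G; x \<in> carrier M; y \<in> carrier M\<rbrakk>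
      \<Longrightarrow> act g (x \<oplus>\<^bsub>M\<^esub> y) = act g x \<oplus>\<^bsub>M\<^esub> act g y"
    and act_smult: "\<lbrakk>g \<in> carrier G; a \<in> carrier R; x \<in> carrier M\<rbrakk>
      \<Longrightarrow> act g (a \<odot>\<^bsub>M\<^esub> x) = a \<odot>\<^bsub>M\<^esub> act g x"

locale RG_submodule = submodule N R M
  for N and G (structure) and R (structure) and M (structure) and act +
  assumes act_closed: "\<lbrakk>g \<in> carrier G; x \<in> N\<rbrakk> \<Longrightarrow> act g x \<in> N"

text \<open>
  If \<open>\<phi>\<close> is additive and maps a subgroup \<open>H\<close> into a subgroup \<open>K\<close> of \<open>L\<close>, then
  \<open>coset_map L K \<phi>\<close> is the induced map sending the coset \<open>H + x\<close> to the coset \<open>K + \<phi> x\<close>.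
  (The cosets \<open>K + \<phi> x\<close> for \<open>x\<close> in the given coset then coincide, so their union is that coset.)
\<close>

definition coset_map ::
  "('b, 'c) ring_scheme \<Rightarrow> 'b set \<Rightarrow> ('a \<Rightarrow> 'b) \<Rightarrow> 'a set \<Rightarrow> 'b set" where
  "coset_map L K \<phi> S = (\<Union>x\<in>S. K +>\<^bsub>L\<^esub> \<phi> x)"

text \<open>
  A module record extends a ring record; the multiplicative fields play no role for modules
  and are left unspecified.
\<close>

definition quot_module ::
  "('r, 'a, 'c) module_scheme \<Rightarrow> 'a set \<Rightarrow> ('r, 'a set) module" where
  "quot_module M H = \<lparr>carrier = a_rcosets\<^bsub>M\<^esub> H, monoid.mult = undefined, monoid.one = undefined,
     ring.zero = H, ring.add = set_add M, module.smult = (\<lambda>a. coset_map M H (\<lambda>x. a \<odot>\<^bsub>M\<^esub> x))\<rparr>"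

definition quot_act ::
  "('r, 'a, 'c) module_scheme \<Rightarrow> 'a set \<Rightarrow> ('g \<Rightarrow> 'a \<Rightarrow> 'a) \<Rightarrow> 'g \<Rightarrow> 'a set \<Rightarrow> 'a set" where
  "quot_act M H act g = coset_map M H (act g)"

text \<open>\<open>nat_multiples M k N\<close> is the subgroup \<open>kN\<close>; since \<open>k\<close> is a natural number, \<open>kx\<close> is the
  \<open>k\<close>-fold sum, which is also the scalar multiple of \<open>x\<close> by the image of \<open>k\<close> in \<open>R\<close>.\<close>

definition nat_multiples :: "('a, 'c) ring_scheme \<Rightarrow> nat \<Rightarrow> 'a set \<Rightarrow> 'a set" where
  "nat_multiples M k N = (\<lambda>x. add_pow M k x) ` N"

definition tuples :: "('g, 'd) monoid_scheme \<Rightarrow> nat \<Rightarrow> 'g list set" where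
  "tuples G n = {gs. length gs = n \<and> set gs \<subseteq> carrier G}"

text \<open>The normalized cochains form an \<open>R\<close>-module under pointwise operations. They are extensional
  (\<open>undefined\<close> outside the set of \<open>n\<close>-tuples), so that equality of cochains is equality of functions
  on \<open>G\<^sup>n\<close> and cochains with values in a submodule are literally cochains of the whole module.\<close>

definition cochains ::
  "('g, 'd) monoid_scheme \<Rightarrow> ('r, 'a, 'c) module_scheme \<Rightarrow> nat \<Rightarrow> ('r, 'g list \<Rightarrow> 'a) module" where
  "cochains G M n =
    \<lparr>carrier = {f \<in> tuples G n \<rightarrow>\<^sub>E carrier M. \<forall>gs\<in>tuples G n. \<one>\<^bsub>G\<^esub> \<in> set gs \<longrightarrow> f gs = \<zero>\<^bsub>M\<^esub>},
     monoid.mult = undefined, monoid.one = undefined,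
     ring.zero = (\<lambda>gs\<in>tuples G n. \<zero>\<^bsub>M\<^esub>),
     ring.add = (\<lambda>f f'. \<lambda>gs\<in>tuples G n. f gs \<oplus>\<^bsub>M\<^esub> f' gs),
     module.smult = (\<lambda>a f. \<lambda>gs\<in>tuples G n. a \<odot>\<^bsub>M\<^esub> f gs)\<rparr>"

text \<open>
  \<open>merge_at G i (g\<^sub>1, \<dots>, g\<^sub>k) = (g\<^sub>1, \<dots>, g\<^sub>i g\<^bsub>i+1\<^esub>, \<dots>, g\<^sub>k)\<close> for \<open>1 \<le> i < k\<close>;
  the entry $g_i$ of a tuple is the list element with index \<open>i - 1\<close>.
\<close>

definition merge_at :: "('g, 'd) monoid_scheme \<Rightarrow> nat \<Rightarrow> 'g list \<Rightarrow> 'g list" where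
  "merge_at G i gs = take (i - 1) gs @ [gs ! (i - 1) \<otimes>\<^bsub>G\<^esub> gs ! i] @ drop (i + 1) gs"

definition coboundary ::
  "('g, 'd) monoid_scheme \<Rightarrow> ('r, 'a, 'c) module_scheme \<Rightarrow> ('g \<Rightarrow> 'a \<Rightarrow> 'a) \<Rightarrow> nat
    \<Rightarrow> ('g list \<Rightarrow> 'a) \<Rightarrow> 'g list \<Rightarrow> 'a" where
  "coboundary G M act n f = (\<lambda>gs\<in>tuples G (n + 1).
     act (hd gs) (f (tl gs))
     \<oplus>\<^bsub>M\<^esub> (\<Oplus>\<^bsub>M\<^esub>i\<in>{1..n}. add_pow M ((-1::int) ^ i) (f (merge_at G i gs)))
     \<oplus>\<^bsub>M\<^esub> add_pow M ((-1::int) ^ (n + 1)) (f (butlast gs)))"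

definition cocycles ::
  "('g, 'd) monoid_scheme \<Rightarrow> ('r, 'a, 'c) module_scheme \<Rightarrow> ('g \<Rightarrow> 'a \<Rightarrow> 'a) \<Rightarrow> nat
    \<Rightarrow> ('g list \<Rightarrow> 'a) set" where
  "cocycles G M act n = a_kernel (cochains G M n) (cochains G M (n + 1)) (coboundary G M act n)"

definition coboundaries ::
  "('g, 'd) monoid_scheme \<Rightarrow> ('r, 'a, 'c) module_scheme \<Rightarrow> ('g \<Rightarrow> 'a \<Rightarrow> 'a) \<Rightarrow> nat
    \<Rightarrow> ('g list \<Rightarrow> 'a) set" where
  "coboundaries G M act n = (case n of
     0 \<Rightarrow> {\<zero>\<^bsub>cochains G M 0\<^esub>}
   | Suc k \<Rightarrow> coboundary G M act k ` carrier (cochains G M k))"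

definition cohomology ::
  "('g, 'd) monoid_scheme \<Rightarrow> ('r, 'a, 'c) module_scheme \<Rightarrow> ('g \<Rightarrow> 'a \<Rightarrow> 'a) \<Rightarrow> nat
    \<Rightarrow> ('r, ('g list \<Rightarrow> 'a) set) module" where
  "cohomology G M act n =
    quot_module ((cochains G M n)\<lparr>carrier := cocycles G M act n\<rparr>) (coboundaries G M act n)"

definition coho_class ::
  "('g, 'd) monoid_scheme \<Rightarrow> ('r, 'a, 'c) module_scheme \<Rightarrow> ('g \<Rightarrow> 'a \<Rightarrow> 'a) \<Rightarrow> nat
    \<Rightarrow> ('g list \<Rightarrow> 'a) \<Rightarrow> ('g list \<Rightarrow> 'a) set" where
  "coho_class G M act n f = coboundaries G M act n +>\<^bsub>cochains G M n\<^esub> f"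

text \<open>The map $H^n(G,L) \to H^n(G,L')$ induced by a homomorphism \<open>\<phi>\<close> from \<open>L\<close> to the
  \<open>RG\<close>-module \<open>(L', act')\<close>.\<close>

definition coho_map ::
  "('g, 'd) monoid_scheme \<Rightarrow> ('r, 'b, 'c) module_scheme \<Rightarrow> ('g \<Rightarrow> 'b \<Rightarrow> 'b) \<Rightarrow> nat
    \<Rightarrow> ('a \<Rightarrow> 'b) \<Rightarrow> ('g list \<Rightarrow> 'a) set \<Rightarrow> ('g list \<Rightarrow> 'b) set" where
  "coho_map G L' act' n \<phi> =
    coset_map (cochains G L' n) (coboundaries G L' act' n) (compose (tuples G n) \<phi>)"

text \<open>
  The connecting homomorphism $H^n(G,C) \to H^{n+1}(G,A)$ of a short exact sequence
  $0 \to A \to B \to C \to 0$ with maps \<open>\<iota>\<close> and \<open>\<pi>\<close>: represent the class by \<open>\<pi> \<circ> f\<close> with a cochain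
  \<open>f\<close> of \<open>B\<close>; then the coboundary of \<open>f\<close> is \<open>\<iota> \<circ> h\<close> for a cocycle \<open>h\<close> of \<open>A\<close>, and the class of \<open>h\<close> is
  the result.
\<close>

definition connecting_hom ::
  "('g, 'd) monoid_scheme \<Rightarrow> ('r, 'a, 'c) module_scheme \<Rightarrow> ('g \<Rightarrow> 'a \<Rightarrow> 'a)
    \<Rightarrow> ('r, 'b, 'e) module_scheme \<Rightarrow> ('g \<Rightarrow> 'b \<Rightarrow> 'b) \<Rightarrow> ('a \<Rightarrow> 'b) \<Rightarrow> ('b \<Rightarrow> 'q) \<Rightarrow> nat
    \<Rightarrow> ('g list \<Rightarrow> 'q) set \<Rightarrow> ('g list \<Rightarrow> 'a) set" where
  "connecting_hom G A actA B actB \<iota> \<pi> n c = (THE d.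
     \<exists>f \<in> carrier (cochains G B n). \<exists>h \<in> cocycles G A actA (n + 1).
       compose (tuples G n) \<pi> f \<in> c
       \<and> coboundary G B actB n f = compose (tuples G (n + 1)) \<iota> h
       \<and> d = coho_class G A actA (n + 1) h)"

definition sub_mod :: "('r, 'a, 'c) module_scheme \<Rightarrow> 'a set \<Rightarrow> ('r, 'a, 'c) module_scheme" where
  "sub_mod M N = M\<lparr>carrier := N\<rparr>"

definition quot_pr :: "('r, 'a, 'c) module_scheme \<Rightarrow> 'a set \<Rightarrow> nat \<Rightarrow> nat \<Rightarrow> ('r, 'a set) module" where
  "quot_pr M N p r = quot_module M (nat_multiples M (p ^ r) N)"

definition quot_pr_act ::
  "('r, 'a, 'c) module_scheme \<Rightarrow> 'a set \<Rightarrow> nat \<Rightarrow> nat \<Rightarrow> ('g \<Rightarrow> 'a \<Rightarrow> 'a) \<Rightarrow> 'g \<Rightarrow> 'a set \<Rightarrow> 'a set" where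
  "quot_pr_act M N p r act = quot_act M (nat_multiples M (p ^ r) N) act"

definition pro :: "('r, 'a, 'c) module_scheme \<Rightarrow> 'a set \<Rightarrow> nat \<Rightarrow> nat \<Rightarrow> 'a \<Rightarrow> 'a set" where
  "pro M N p r x = nat_multiples M (p ^ r) N +>\<^bsub>M\<^esub> x"

text \<open>\<open>quot_proj M N p s\<close> is the projection $M/p^rN \to M/p^sN$ for any \<open>r \<ge> s\<close>.\<close>

definition quot_proj :: "('r, 'a, 'c) module_scheme \<Rightarrow> 'a set \<Rightarrow> nat \<Rightarrow> nat \<Rightarrow> 'a set \<Rightarrow> 'a set" where
  "quot_proj M N p s = coset_map M (nat_multiples M (p ^ s) N) (\<lambda>x. x)"

text \<open>
  The inverse of the injective map \<open>pro\<^bsub>r-m\<^esub>\<close> on cohomology is taken on its image, which contains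
  the image of the map induced by the projection $M/p^rN \to M/p^{r-m}N$.
\<close>

definition Phi ::
  "('g, 'd) monoid_scheme \<Rightarrow> ('r, 'a, 'c) module_scheme \<Rightarrow> ('g \<Rightarrow> 'a \<Rightarrow> 'a) \<Rightarrow> 'a set
    \<Rightarrow> nat \<Rightarrow> nat \<Rightarrow> nat \<Rightarrow> nat
    \<Rightarrow> ('g list \<Rightarrow> 'a set) set \<Rightarrow> ('g list \<Rightarrow> 'a) set \<times> ('g list \<Rightarrow> 'a) set" where
  "Phi G M act N p m n r c =
    (inv_into (carrier (cohomology G M act n))
       (coho_map G (quot_pr M N p (r - m)) (quot_pr_act M N p (r - m) act) n (pro M N p (r - m)))
       (coho_map G (quot_pr M N p (r - m)) (quot_pr_act M N p (r - m) act) n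
         (quot_proj M N p (r - m)) c),
     connecting_hom G (sub_mod M N) act M act (\<lambda>x. add_pow M (p ^ r) x) (pro M N p r) n c)"

end

(*
  Summing the cocycle identity over the last argument shows that |G| = p^m kills cohomology in
  positive degrees, already on the level of cocycles of N. This yields sigma, and as p is injective
  on N, it also shows that pro_s is injective on cohomology for s >= m.

  Every cochain of M/p^rN lifts to a cochain f of M, and it is a cocycle iff the coboundary of f is
  p^r h with h a cochain of N; then h is a cocycle that represents the connecting homomorphism.
  Choosing sigma with coboundary p^m h, rho = f - p^(r-m) sigma is a cocycle of M with
  pro_(r-m) f = pro_(r-m) rho. Hence every class is of the form considered in the theorem, and its
  image under Phi can be read off. If rho and h change by coboundaries of u and w, then sigma
  changes by p^m w + tau with tau a cocycle of N, so that f changes by the coboundary of u, by p^r w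
  and by p^(r-m) tau. The last term is a coboundary because r - m >= m.
*)

theory Submission
  imports Defs
begin

section \<open>Abelian groups\<close>

text \<open>The factor p^(r-m) on \<open>\<sigma>\<close> does two things. It raises the coboundary
  p^m \<open>\<eta>\<close> to p^r \<open>\<eta>\<close>, which is what both the cocycle condition
  modulo p^r N and the connecting homomorphism ask for. It also disappears modulo p^(r-m) N, so that
  the component in H^n(G,M) sees \<open>\<rho>\<close> alone. The bound 2m <= r acts as m <= r - m:
  once to make \<open>inv_into\<close> in \<open>Phi\<close> return the expected class, and once for
  uniqueness. M may have p-torsion, so powers of p can be cancelled only in N. Every error term is
  therefore kept in the form p^s w with w a cochain of N, and w must itself be normalized; this is
  why lifts and quotients by p^s are chosen to vanish on tuples with a trivial entry.
  \<open>Phi\<close> is assembled from \<open>inv_into\<close> and a definite description, so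
  nothing is known about it until it is evaluated on representatives. Uniqueness is then proved by
  comparing cochains.\<close>

lemma (in abelian_group_hom) hom_add_pow_nat:
  "x \<in> carrier G \<Longrightarrow> h (add_pow G (k::nat) x) = add_pow H k (h x)"
  by (induction k) (simp_all)

lemma (in abelian_group_hom) hom_add_pow_int:
  "x \<in> carrier G \<Longrightarrow> h (add_pow G (k::int) x) = add_pow H k (h x)"
  by (cases "k \<ge> 0") (simp_all add: add_pow_int_ge add_pow_int_lt hom_add_pow_nat)

lemma (in abelian_group_hom) hom_finsum:
  "f \<in> A \<rightarrow> carrier G \<Longrightarrow> h (finsum G f A) = finsum H (\<lambda>i. h (f i)) A"
  by (induction A rule: infinite_finite_induct) (simp_all add: Pi_def)

lemma abelian_group_homI':
  assumes "abelian_group A" "abelian_group B"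
    and "\<And>x. x \<in> carrier A \<Longrightarrow> h x \<in> carrier B"
    and "\<And>x y. x \<in> carrier A \<Longrightarrow> y \<in> carrier A \<Longrightarrow> h (x \<oplus>\<^bsub>A\<^esub> y) = h x \<oplus>\<^bsub>B\<^esub> h y"
  shows "abelian_group_hom A B h"
  using assms
  by (intro abelian_group_homI group_hom.intro group_hom_axioms.intro homI)
    (auto intro: abelian_group.a_group)

lemma (in abelian_group) add_pow_nat_hom: "abelian_group_hom G G (\<lambda>x. add_pow G (k::nat) x)"
  by (rule abelian_group_homI') (auto simp: abelian_group_axioms add.nat_pow_distrib)

lemma (in abelian_monoid) finsum_swap:
  assumes "finite B" "\<And>x i. x \<in> A \<Longrightarrow> i \<in> B \<Longrightarrow> f x i \<in> carrier G"
  shows "(\<Oplus>x\<in>A. \<Oplus>i\<in>B. f x i) = (\<Oplus>i\<in>B. \<Oplus>x\<in>A. f x i)"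
  using assms
proof (induction B rule: finite_induct)
  case (insert j B)
  have "(\<Oplus>x\<in>A. \<Oplus>i\<in>insert j B. f x i) = (\<Oplus>x\<in>A. f x j \<oplus> (\<Oplus>i\<in>B. f x i))"
    using insert by (intro finsum_cong') (auto intro!: finsum_closed a_closed finsum_insert)
  also have "\<dots> = (\<Oplus>x\<in>A. f x j) \<oplus> (\<Oplus>x\<in>A. \<Oplus>i\<in>B. f x i)"
    using insert.prems by (intro finsum_addf) (auto intro!: finsum_closed)
  also have "\<dots> = (\<Oplus>i\<in>insert j B. \<Oplus>x\<in>A. f x i)"
    using insert by (subst finsum_insert) (auto intro!: finsum_closed)
  finally show ?case .
qed simp

text \<open>The relation on \<open>S\<close> is the one satisfied by the terms of an iterated alternating
  sum over faces; it lets the terms cancel in pairs.\<close>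

lemma (in abelian_group) double_sum_cancel:
  assumes "\<And>i j. i \<le> k \<Longrightarrow> j \<le> Suc k \<Longrightarrow> S i j \<in> carrier G"
    and "\<And>i j. i < j \<Longrightarrow> j \<le> Suc k \<Longrightarrow> S i j = \<ominus> S (j - 1) i"
  shows "(\<Oplus>j\<in>{..Suc k}. \<Oplus>i\<in>{..k}. S i j) = \<zero>"
  using assms
proof (induction k)
  case 0
  then have "S 0 (Suc 0) = \<ominus> S 0 0" by simp
  then show ?case using 0(1) by (simp add: finsum_Suc l_neg)
next
  case (Suc k)
  let ?k = "Suc k" let ?l = "Suc (Suc k)"
  have row: "(\<Oplus>i\<in>{..?k}. S i j) = S ?k j \<oplus> (\<Oplus>i\<in>{..k}. S i j)" if "j \<le> ?l" for j
    using Suc.prems(1) that by (intro finsum_Suc) auto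
  have "(\<Oplus>j\<in>{..?l}. \<Oplus>i\<in>{..?k}. S i j)
      = (\<Oplus>i\<in>{..?k}. S i ?l) \<oplus> (\<Oplus>j\<in>{..?k}. \<Oplus>i\<in>{..?k}. S i j)"
    using Suc.prems(1) by (intro finsum_Suc) (auto intro!: finsum_closed)
  also have "(\<Oplus>j\<in>{..?k}. \<Oplus>i\<in>{..?k}. S i j) = (\<Oplus>j\<in>{..?k}. S ?k j \<oplus> (\<Oplus>i\<in>{..k}. S i j))"
  proof (intro finsum_cong')
    show "(\<lambda>j. S ?k j \<oplus> (\<Oplus>i\<in>{..k}. S i j)) \<in> {..?k} \<rightarrow> carrier G"
      using Suc.prems(1) by (auto intro!: finsum_closed a_closed)
  qed (use row in auto)
  also have "\<dots> = (\<Oplus>j\<in>{..?k}. S ?k j) \<oplus> (\<Oplus>j\<in>{..?k}. \<Oplus>i\<in>{..k}. S i j)"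
    using Suc.prems(1) by (intro finsum_addf) (auto intro!: finsum_closed)
  also have "(\<Oplus>j\<in>{..?k}. \<Oplus>i\<in>{..k}. S i j) = \<zero>"
    using Suc.prems by (intro Suc.IH) auto
  \<comment> \<open>The new column is paired with the new row: for the largest j the relation reads
    S i j = - S (Suc k) i.\<close>
  also have "(\<Oplus>i\<in>{..?k}. S i ?l) = (\<Oplus>i\<in>{..?k}. \<ominus> S ?k i)"
    using Suc.prems by (intro finsum_cong') auto
  also have "(\<Oplus>i\<in>{..?k}. \<ominus> S ?k i) \<oplus> ((\<Oplus>j\<in>{..?k}. S ?k j) \<oplus> \<zero>)
     = (\<Oplus>i\<in>{..?k}. \<ominus> S ?k i \<oplus> S ?k i)"
    using Suc.prems(1) by (subst finsum_addf) (auto simp: finsum_closed Pi_def)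
  also have "\<dots> = \<zero>"
    using Suc.prems(1) by (intro add.finprod_one_eqI) (simp add: l_neg)
  finally show ?case .
qed

section \<open>Cosets and quotient groups\<close>

lemma coset_map_coset:
  assumes "abelian_subgroup H A" "abelian_subgroup K B" "abelian_group_hom A B \<phi>"
    and HK: "\<And>h. h \<in> H \<Longrightarrow> \<phi> h \<in> K" and x: "x \<in> carrier A"
  shows "coset_map B K \<phi> (H +>\<^bsub>A\<^esub> x) = K +>\<^bsub>B\<^esub> \<phi> x"
proof -
  interpret H: abelian_subgroup H A by fact
  interpret K: abelian_subgroup K B by fact
  interpret abelian_group_hom A B \<phi> by fact
  have "K +>\<^bsub>B\<^esub> \<phi> y = K +>\<^bsub>B\<^esub> \<phi> x" if y: "y \<in> H +>\<^bsub>A\<^esub> x" for y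
  proof -
    obtain h where "h \<in> H" "y = h \<oplus>\<^bsub>A\<^esub> x" using y by (auto simp: a_r_coset_def')
    then have "\<phi> y \<in> K +>\<^bsub>B\<^esub> \<phi> x" using HK x by (auto simp: a_r_coset_def')
    then show ?thesis using K.a_repr_independence' x by simp
  qed
  \<comment> \<open>All members of the union that defines \<open>coset_map\<close> agree, and there
    is at least one because x lies in its own coset.\<close>
  then show ?thesis using H.a_rcos_self[OF x] unfolding coset_map_def by blast
qed

lemma quot_module_abelian_group:
  assumes "abelian_subgroup H M"
  shows "abelian_group (quot_module M H)"
proof -
  interpret H: abelian_subgroup H M by fact
  have car: "carrier (quot_module M H) = (\<lambda>x. H +>\<^bsub>M\<^esub> x) ` carrier M"
    by (auto simp: quot_module_def A_RCOSETS_def')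
  have add: "(H +>\<^bsub>M\<^esub> x) \<oplus>\<^bsub>quot_module M H\<^esub> (H +>\<^bsub>M\<^esub> y) = H +>\<^bsub>M\<^esub> (x \<oplus>\<^bsub>M\<^esub> y)"
    if "x \<in> carrier M" "y \<in> carrier M" for x y
    using H.a_rcos_sum that by (simp add: quot_module_def)
  have zero: "\<zero>\<^bsub>quot_module M H\<^esub> = H +>\<^bsub>M\<^esub> \<zero>\<^bsub>M\<^esub>"
    using H.a_subset by (simp add: quot_module_def)
  show ?thesis
  proof (rule abelian_groupI)
    fix S assume "S \<in> carrier (quot_module M H)"
    then obtain x where "x \<in> carrier M" "S = H +>\<^bsub>M\<^esub> x" by (auto simp: car)
    then show "\<exists>T\<in>carrier (quot_module M H). T \<oplus>\<^bsub>quot_module M H\<^esub> S = \<zero>\<^bsub>quot_module M H\<^esub>"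
      by (intro bexI[of _ "H +>\<^bsub>M\<^esub> (\<ominus>\<^bsub>M\<^esub> x)"]) (auto simp: car add zero H.l_neg)
  qed (auto simp: car add zero H.a_ac)
qed

section \<open>Faces of tuples\<close>

text \<open>\<open>face G i\<close> is \<open>tl\<close> for \<open>i = 0\<close>, \<open>merge_at G i\<close> for \<open>0 < i < length gs\<close> and \<open>butlast\<close> for
  \<open>i = length gs\<close>; together with \<open>face_coeff\<close>, which carries the action of \<open>g\<^sub>1\<close>, this turns the
  coboundary into a single alternating sum.\<close>

fun face :: "('g, 'd) monoid_scheme \<Rightarrow> nat \<Rightarrow> 'g list \<Rightarrow> 'g list" where
  "face G 0 gs = tl gs"
| "face G (Suc 0) (g # h # gs) = (g \<otimes>\<^bsub>G\<^esub> h) # gs"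
| "face G (Suc (Suc i)) (g # gs) = g # face G (Suc i) gs"
| "face G (Suc 0) [g] = []"
| "face G (Suc i) [] = []"

definition face_coeff :: "('g, 'd) monoid_scheme \<Rightarrow> nat \<Rightarrow> 'g list \<Rightarrow> 'g" where
  "face_coeff G i gs = (if i = 0 then hd gs else \<one>\<^bsub>G\<^esub>)"

lemma face_length: "i \<le> length gs \<Longrightarrow> length (face G i gs) = length gs - 1"
proof (induction G i gs rule: face.induct)
  case (3 G i g gs) then show ?case by (cases gs) auto
qed auto

lemma face_last: "gs \<noteq> [] \<Longrightarrow> face G (length gs) gs = butlast gs"
proof (induction gs)
  case (Cons g gs) then show ?case by (cases gs) auto
qed simp

text \<open>Needed for the sum over the last entry x. Below the top face, this is the only face in
  which x is altered; in all others it is just carried along, as in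
  \<open>face_append_singleton\<close>.\<close>

lemma face_append_last:
  "gs \<noteq> [] \<Longrightarrow> face G (length gs) (gs @ [x]) = butlast gs @ [last gs \<otimes>\<^bsub>G\<^esub> x]"
proof (induction gs)
  case (Cons g gs) then show ?case by (cases gs) auto
qed simp

lemma face_merge_at: "1 \<le> i \<Longrightarrow> i < length gs \<Longrightarrow> face G i gs = merge_at G i gs"
proof (induction G i gs rule: face.induct)
  case (3 G i g gs) then show ?case by (simp add: merge_at_def)
qed (auto simp: merge_at_def)

lemma face_append_singleton: "1 \<le> i \<Longrightarrow> i < length gs \<Longrightarrow> face G i (gs @ [x]) = face G i gs @ [x]"
proof (induction G i gs rule: face.induct)
  case (3 G i g gs) then show ?case by simp
qed auto

lemma (in monoid) face_carrier: "set gs \<subseteq> carrier G \<Longrightarrow> set (face G i gs) \<subseteq> carrier G"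
proof (induction gs arbitrary: i)
  case Nil then show ?case by (cases i) auto
next
  case (Cons g gs)
  consider "i = 0" | "i = 1" | j where "i = Suc (Suc j)"
    by (metis One_nat_def not0_implies_Suc)
  then show ?case
  proof cases
    case 1 then show ?thesis using Cons.prems by simp
  next
    case 2 then show ?thesis using Cons.prems by (cases gs) auto
  next
    case (3 j) then show ?thesis using Cons.IH[of "Suc j"] Cons.prems by simp
  qed
qed

text \<open>The simplicial identity of the bar construction. It has content only for adjacent
  merges, where it is associativity; otherwise the two operations touch different entries.\<close>

lemma (in monoid) face_face:
  assumes "set gs \<subseteq> carrier G" "i < j" "j \<le> length gs" "2 \<le> length gs"
  shows "face G i (face G j gs) = face G (j - 1) (face G i gs)"
  using assms
proof (induction gs arbitrary: i j)
  case (Cons g gs)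
  obtain h gs' where gs: "gs = h # gs'" using Cons.prems(4) by (cases gs) auto
  consider "i = 0" | "i = 1" | k where "i = Suc (Suc k)"
    by (metis One_nat_def not0_implies_Suc)
  then show ?case
  proof cases
    case 1
    obtain k where "j = Suc k" using Cons.prems(2) by (cases j) auto
    then show ?thesis using 1 gs by (cases k) auto
  next
    case 2
    obtain k where "j = Suc (Suc k)" using Cons.prems(2) 2 less_iff_Suc_add[of 1 j] by auto
    then show ?thesis using 2 gs Cons.prems
      by (cases k; cases gs') (auto simp: m_assoc)
  next
    case 3
    obtain l where j: "j = Suc (Suc (Suc l))"
      using Cons.prems(2) 3 less_iff_Suc_add[of "Suc (Suc k)" j] by auto
    have "face G (Suc k) (face G (Suc (Suc l)) gs) = face G (Suc l) (face G (Suc k) gs)"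
      using Cons.IH[of "Suc k" "Suc (Suc l)"] Cons.prems 3 gs j by simp
    then show ?thesis using 3 j by simp
  qed
qed simp

text \<open>The companion of \<open>face_face\<close> for the acting elements. The essential case is
  i = 0, j = 1: the head of the merged tuple is the product of the first two entries, which the
  other order of faces strips off one at a time.\<close>

lemma (in monoid) face_coeff_face:
  assumes "set gs \<subseteq> carrier G" "i < j" "j \<le> length gs" "2 \<le> length gs"
  shows "face_coeff G j gs \<otimes> face_coeff G i (face G j gs)
    = face_coeff G i gs \<otimes> face_coeff G (j - 1) (face G i gs)"
proof -
  obtain g h gs' where gs: "gs = g # h # gs'" using assms(4)
    by (cases gs; cases "tl gs") auto
  obtain k where j: "j = Suc k" using assms(2) by (cases j) auto
  show ?thesis using assms(1,2) by (cases k) (auto simp: face_coeff_def gs j)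
qed

text \<open>With positions counted from 0, the faces i and Suc i are the two that involve entry i.
  Each drops it or multiplies it into a neighbour, so a trivial entry is deleted by both. Every
  other face keeps it, which is \<open>one_in_face\<close>.\<close>

lemma (in monoid) face_eq_if_one:
  assumes "set gs \<subseteq> carrier G" "i < length gs" "gs ! i = \<one>"
  shows "face G i gs = face G (Suc i) gs \<and> face_coeff G i gs = \<one>"
  using assms
proof (induction gs arbitrary: i)
  case (Cons g gs)
  consider "i = 0" | "i = 1" | k where "i = Suc (Suc k)"
    by (metis One_nat_def not0_implies_Suc)
  then show ?case
  proof cases
    case 1
    then show ?thesis using Cons.prems by (cases gs) (auto simp: face_coeff_def)
  next
    case 2
    then show ?thesis using Cons.prems by (cases gs; cases "tl gs") (auto simp: face_coeff_def)
  next
    case 3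
    then show ?thesis using Cons.IH[of "Suc k"] Cons.prems by (auto simp: face_coeff_def)
  qed
qed simp

lemma (in monoid) one_in_face:
  assumes "set gs \<subseteq> carrier G" "i < length gs" "gs ! i = \<one>" "j \<le> length gs" "j \<noteq> i" "j \<noteq> Suc i"
  shows "\<one> \<in> set (face G j gs)"
  using assms
proof (induction gs arbitrary: i j)
  case (Cons g gs)
  consider "j = 0" | "j = 1" | k where "j = Suc (Suc k)"
    by (metis One_nat_def not0_implies_Suc)
  then show ?case
  proof cases
    case 1
    then show ?thesis using Cons.prems by (cases i) (auto simp: in_set_conv_nth)
  next
    case 2
    then obtain l where "i = Suc (Suc l)" using Cons.prems(5,6)
      by (metis One_nat_def not0_implies_Suc)
    then show ?thesis using Cons.prems 2 by (cases gs) (auto simp: in_set_conv_nth)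
  next
    case 3
    show ?thesis
    proof (cases i)
      case 0 then show ?thesis using 3 Cons.prems by simp
    next
      case (Suc l)
      then show ?thesis using 3 Cons.IH[of l "Suc k"] Cons.prems by simp
    qed
  qed
qed simp

lemma (in monoid) face_tuples: "gs \<in> tuples G (Suc n) \<Longrightarrow> i \<le> Suc n \<Longrightarrow> face G i gs \<in> tuples G n"
  using face_carrier by (auto simp: tuples_def face_length)

lemma (in monoid) face_coeff_closed:
  "gs \<in> tuples G (Suc n) \<Longrightarrow> face_coeff G i gs \<in> carrier G"
  by (cases gs) (auto simp: tuples_def face_coeff_def)

section \<open>Cochains with values in a module\<close>

text \<open>The common interface for M, N and all quotients M/p^r N: an abelian group with an
  action, which is what coboundaries and cohomology classes are made of.\<close>

locale G_module = M?: abelian_group M + G?: group G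
  for M :: "('r, 'a, 'c) module_scheme" (structure) and G :: "('g, 'd) monoid_scheme"
    and act :: "'g \<Rightarrow> 'a \<Rightarrow> 'a" +
  assumes act_closed: "\<lbrakk>g \<in> carrier G; x \<in> carrier M\<rbrakk> \<Longrightarrow> act g x \<in> carrier M"
    and act_one: "x \<in> carrier M \<Longrightarrow> act \<one>\<^bsub>G\<^esub> x = x"
    and act_mult: "\<lbrakk>g \<in> carrier G; h \<in> carrier G; x \<in> carrier M\<rbrakk>
      \<Longrightarrow> act (g \<otimes>\<^bsub>G\<^esub> h) x = act g (act h x)"
    and act_add: "\<lbrakk>g \<in> carrier G; x \<in> carrier M; y \<in> carrier M\<rbrakk>
      \<Longrightarrow> act g (x \<oplus> y) = act g x \<oplus> act g y"
begin

lemma act_hom: "g \<in> carrier G \<Longrightarrow> abelian_group_hom M M (act g)"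
  by (intro abelian_group_homI') (auto simp: M.abelian_group_axioms act_closed act_add)

lemma cochainsI:
  assumes "f \<in> extensional (tuples G n)" "\<And>gs. gs \<in> tuples G n \<Longrightarrow> f gs \<in> carrier M"
    "\<And>gs. gs \<in> tuples G n \<Longrightarrow> \<one>\<^bsub>G\<^esub> \<in> set gs \<Longrightarrow> f gs = \<zero>"
  shows "f \<in> carrier (cochains G M n)"
  using assms by (auto simp: cochains_def PiE_def)

lemma cochainsD:
  assumes "f \<in> carrier (cochains G M n)"
  shows "f \<in> extensional (tuples G n)" "gs \<in> tuples G n \<Longrightarrow> f gs \<in> carrier M"
    "gs \<in> tuples G n \<Longrightarrow> \<one>\<^bsub>G\<^esub> \<in> set gs \<Longrightarrow> f gs = \<zero>"
  using assms by (auto simp: cochains_def PiE_def)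

lemma cochains_eqI:
  assumes "f \<in> carrier (cochains G M n)" "f' \<in> carrier (cochains G M n)"
    "\<And>gs. gs \<in> tuples G n \<Longrightarrow> f gs = f' gs"
  shows "f = f'"
  using assms cochainsD(1) by (metis extensionalityI)

lemma cochains_add_apply:
  "gs \<in> tuples G n \<Longrightarrow> (f \<oplus>\<^bsub>cochains G M n\<^esub> f') gs = f gs \<oplus> f' gs"
  by (simp add: cochains_def)

lemma cochains_zero_apply: "gs \<in> tuples G n \<Longrightarrow> \<zero>\<^bsub>cochains G M n\<^esub> gs = \<zero>"
  by (simp add: cochains_def)

lemma cochains_add_closed:
  assumes "f \<in> carrier (cochains G M n)" "f' \<in> carrier (cochains G M n)"
  shows "f \<oplus>\<^bsub>cochains G M n\<^esub> f' \<in> carrier (cochains G M n)"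
  using assms[THEN cochainsD(2)] assms[THEN cochainsD(3)]
  by (intro cochainsI) (auto simp: cochains_add_apply, auto simp: cochains_def)

lemma cochains_zero_closed: "\<zero>\<^bsub>cochains G M n\<^esub> \<in> carrier (cochains G M n)"
  by (intro cochainsI) (auto simp: cochains_zero_apply, auto simp: cochains_def)

lemma cochains_abelian_group: "abelian_group (cochains G M n)"
proof (rule abelian_groupI)
  fix f assume f: "f \<in> carrier (cochains G M n)"
  define f' where "f' = (\<lambda>gs\<in>tuples G n. \<ominus> f gs)"
  have "f' \<in> carrier (cochains G M n)"
    using f[THEN cochainsD(2)] f[THEN cochainsD(3)] by (intro cochainsI) (auto simp: f'_def)
  moreover from this have "f' \<oplus>\<^bsub>cochains G M n\<^esub> f = \<zero>\<^bsub>cochains G M n\<^esub>"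
    using f[THEN cochainsD(2)]
    by (intro cochains_eqI[where n = n])
      (auto simp: f cochains_add_closed cochains_zero_closed cochains_add_apply
        cochains_zero_apply f'_def l_neg)
  ultimately show "\<exists>f' \<in> carrier (cochains G M n). f' \<oplus>\<^bsub>cochains G M n\<^esub> f = \<zero>\<^bsub>cochains G M n\<^esub>"
    by blast
qed (auto intro!: cochains_eqI[where n = n] cochains_add_closed cochains_zero_closed
    simp: cochains_add_apply cochains_zero_apply cochainsD a_ac)

lemma cochains_minus_apply:
  assumes "f \<in> carrier (cochains G M n)" "gs \<in> tuples G n"
  shows "(\<ominus>\<^bsub>cochains G M n\<^esub> f) gs = \<ominus> f gs"
proof -
  interpret C: abelian_group "cochains G M n" by (rule cochains_abelian_group)
  have "(\<ominus>\<^bsub>cochains G M n\<^esub> f) gs \<oplus> f gs = \<zero>"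
    using assms C.l_neg[of f] cochains_add_apply[of gs n "\<ominus>\<^bsub>cochains G M n\<^esub> f" f]
    by (simp add: cochains_zero_apply)
  then show ?thesis
    using assms cochainsD(2)[OF C.a_inv_closed] cochainsD(2)[OF assms(1)]
    by (intro minus_equality[symmetric]) auto
qed

lemma cochains_add_pow_apply:
  "gs \<in> tuples G n \<Longrightarrow> add_pow (cochains G M n) (k::nat) f gs = add_pow M k (f gs)"
  by (induction k) (simp_all add: add_pow_def, simp_all add: cochains_def)

section \<open>The coboundary as a sum of face terms\<close>

definition face_term :: "nat \<Rightarrow> ('g list \<Rightarrow> 'a) \<Rightarrow> 'g list \<Rightarrow> 'a" where
  "face_term i f gs = add_pow M ((-1::int) ^ i) (act (face_coeff G i gs) (f (face G i gs)))"

lemma face_term_closed: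
  assumes "f \<in> carrier (cochains G M n)" "gs \<in> tuples G (Suc n)" "i \<le> Suc n"
  shows "face_term i f gs \<in> carrier M"
  using assms cochainsD(2)[OF assms(1) G.face_tuples] G.face_coeff_closed
  by (auto simp: face_term_def act_closed)

lemma coboundary_apply:
  assumes f: "f \<in> carrier (cochains G M n)" and gs: "gs \<in> tuples G (Suc n)"
  shows "coboundary G M act n f gs = (\<Oplus>i\<in>{..Suc n}. face_term i f gs)"
proof -
  note cl = face_term_closed[OF f gs]
  have len: "length gs = Suc n" using gs by (simp add: tuples_def)
  have fc: "f (face G i gs) \<in> carrier M" if "i \<le> Suc n" for i
    using G.face_tuples[OF gs that] cochainsD(2)[OF f] by blast
  have eq: "{..Suc n} = insert (Suc n) (insert 0 {1..n})" by auto
  have z: "face_term 0 f gs = act (hd gs) (f (tl gs))"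
    using G.face_coeff_closed[OF gs, of 0] fc[of 0]
    by (auto simp: face_term_def face_coeff_def act_closed)
  have l: "face_term (Suc n) f gs = add_pow M ((-1::int) ^ (n + 1)) (f (butlast gs))"
    using len fc[of "Suc n"] face_last[of gs G]
    by (cases "gs = []") (auto simp: face_term_def face_coeff_def act_one)
  have m: "(\<Oplus>i\<in>{1..n}. add_pow M ((-1::int) ^ i) (f (merge_at G i gs)))
     = (\<Oplus>i\<in>{1..n}. face_term i f gs)"
    using len fc cl
    by (intro finsum_cong') (auto simp: face_term_def face_coeff_def act_one face_merge_at[symmetric])
  have mc: "(\<Oplus>i\<in>{1..n}. face_term i f gs) \<in> carrier M"
    using cl by (intro finsum_closed) auto
  have "coboundary G M act n f gs
      = face_term 0 f gs \<oplus> (\<Oplus>i\<in>{1..n}. face_term i f gs) \<oplus> face_term (Suc n) f gs"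
    unfolding z l m[symmetric] using gs by (simp add: coboundary_def)
  also have "\<dots> = (\<Oplus>i\<in>{..Suc n}. face_term i f gs)"
    unfolding eq using cl mc by (simp add: a_ac Pi_def)
  finally show ?thesis .
qed

text \<open>The point is normalization. If entry i is trivial, all terms except those of the faces i
  and Suc i vanish since f is normalized, and these two are equal up to opposite signs.\<close>

lemma coboundary_closed:
  assumes f: "f \<in> carrier (cochains G M n)"
  shows "coboundary G M act n f \<in> carrier (cochains G M (Suc n))"
proof (rule cochainsI)
  show "coboundary G M act n f \<in> extensional (tuples G (Suc n))"
    by (simp add: coboundary_def)
  fix gs assume gs: "gs \<in> tuples G (Suc n)"
  note cl = face_term_closed[OF f gs]
  show "coboundary G M act n f gs \<in> carrier M"
    unfolding coboundary_apply[OF f gs] using cl by (intro finsum_closed) auto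
  assume "\<one>\<^bsub>G\<^esub> \<in> set gs"
  then obtain i where i: "i < length gs" "gs ! i = \<one>\<^bsub>G\<^esub>" by (auto simp: in_set_conv_nth)
  have len: "length gs = Suc n" and sub: "set gs \<subseteq> carrier G" using gs by (auto simp: tuples_def)
  have z: "face_term j f gs = \<zero>" if "j \<le> Suc n" "j \<noteq> i" "j \<noteq> Suc i" for j
  proof -
    have "\<one>\<^bsub>G\<^esub> \<in> set (face G j gs)"
      using G.one_in_face[OF sub i] that len by simp
    then have "f (face G j gs) = \<zero>"
      using cochainsD(3)[OF f G.face_tuples[OF gs]] that by simp
    then show ?thesis
      using abelian_group_hom.hom_zero[OF act_hom] G.face_coeff_closed[OF gs]
      by (simp add: face_term_def)
  qed
  have c: "face_term (Suc i) f gs = \<ominus> face_term i f gs"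
  proof -
    have "f (face G i gs) \<in> carrier M"
      using G.face_tuples[OF gs, of i] cochainsD(2)[OF f] i(1) len by simp
    then show ?thesis
      using G.face_eq_if_one[OF sub i] by (simp add: face_term_def face_coeff_def[of _ "Suc i"] add.int_pow_neg act_one)
  qed
  have "(\<Oplus>j\<in>{..Suc n}. face_term j f gs) = (\<Oplus>j\<in>{i, Suc i}. face_term j f gs)"
    using z cl i(1) len by (intro add.finprod_mono_neutral_cong_right) auto
  also have "\<dots> = \<zero>"
    using cl[of i] i(1) len c by (simp add: r_neg)
  finally show "coboundary G M act n f gs = \<zero>"
    using coboundary_apply[OF f gs] by simp
qed

lemma face_term_add:
  assumes "f \<in> carrier (cochains G M n)" "f' \<in> carrier (cochains G M n)"
    "gs \<in> tuples G (Suc n)" "i \<le> Suc n"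
  shows "face_term i (f \<oplus>\<^bsub>cochains G M n\<^esub> f') gs = face_term i f gs \<oplus> face_term i f' gs"
  using assms G.face_tuples[OF assms(3,4)] G.face_coeff_closed[OF assms(3)]
  by (simp add: face_term_def cochains_add_apply act_add act_closed cochainsD(2) add.int_pow_distrib)

lemma coboundary_hom:
  "abelian_group_hom (cochains G M n) (cochains G M (Suc n)) (coboundary G M act n)"
proof (rule abelian_group_homI')
  fix f f' assume f: "f \<in> carrier (cochains G M n)" and f': "f' \<in> carrier (cochains G M n)"
  note cl = cochains_add_closed[OF f f']
  show "coboundary G M act n (f \<oplus>\<^bsub>cochains G M n\<^esub> f')
    = coboundary G M act n f \<oplus>\<^bsub>cochains G M (Suc n)\<^esub> coboundary G M act n f'"
  proof (rule cochains_eqI)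
    fix gs assume gs: "gs \<in> tuples G (Suc n)"
    have "(\<Oplus>i\<in>{..Suc n}. face_term i (f \<oplus>\<^bsub>cochains G M n\<^esub> f') gs)
        = (\<Oplus>i\<in>{..Suc n}. face_term i f gs \<oplus> face_term i f' gs)"
      using face_term_add[OF f f' gs] face_term_closed[OF f gs] face_term_closed[OF f' gs]
      by (intro finsum_cong') auto
    also have "\<dots> = (\<Oplus>i\<in>{..Suc n}. face_term i f gs) \<oplus> (\<Oplus>i\<in>{..Suc n}. face_term i f' gs)"
      using face_term_closed[OF f gs] face_term_closed[OF f' gs] by (intro finsum_addf) auto
    finally show "coboundary G M act n (f \<oplus>\<^bsub>cochains G M n\<^esub> f') gs
      = (coboundary G M act n f \<oplus>\<^bsub>cochains G M (Suc n)\<^esub> coboundary G M act n f') gs"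
      by (simp add: cochains_add_apply[OF gs] coboundary_apply[OF _ gs] f f' cl)
  qed (simp_all add: f f' cl coboundary_closed cochains_add_closed)
qed (simp_all add: cochains_abelian_group coboundary_closed)

text \<open>Both coboundaries are expanded into a double sum S with inner index i and outer index j.
  For i < j the simplicial identity matches S i j with S (j - 1) i, and the exponents i + j and i +
  j - 1 of the sign differ by one.\<close>

lemma coboundary_coboundary:
  assumes f: "f \<in> carrier (cochains G M n)"
  shows "coboundary G M act (Suc n) (coboundary G M act n f) = \<zero>\<^bsub>cochains G M (Suc (Suc n))\<^esub>"
proof (rule cochains_eqI)
  fix gs assume gs: "gs \<in> tuples G (Suc (Suc n))"
  note df = coboundary_closed[OF f]
  have len: "length gs = Suc (Suc n)" and sub: "set gs \<subseteq> carrier G" using gs by (auto simp: tuples_def)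
  define S where "S i j = add_pow M ((-1::int) ^ j)
      (act (face_coeff G j gs) (face_term i f (face G j gs)))" for i j
  have cl: "S i j \<in> carrier M" if "i \<le> Suc n" "j \<le> Suc (Suc n)" for i j
    using that face_term_closed[OF f G.face_tuples[OF gs]] G.face_coeff_closed[OF gs]
    by (auto simp: S_def act_closed)
  have S: "S i j = add_pow M ((-1::int) ^ (i + j))
     (act (face_coeff G j gs \<otimes>\<^bsub>G\<^esub> face_coeff G i (face G j gs)) (f (face G i (face G j gs))))"
    if "i \<le> Suc n" "j \<le> Suc (Suc n)" for i j
  proof -
    have fc: "f (face G i (face G j gs)) \<in> carrier M"
      using that cochainsD(2)[OF f] G.face_tuples G.face_tuples[OF gs] by blast
    have c: "face_coeff G j gs \<in> carrier G" "face_coeff G i (face G j gs) \<in> carrier G"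
      using G.face_coeff_closed gs G.face_tuples[OF gs that(2)] by blast+
    show ?thesis
      using fc c abelian_group_hom.hom_add_pow_int[OF act_hom[OF c(1)]]
      by (simp add: S_def face_term_def act_mult act_closed add.int_pow_pow power_add mult.commute)
  qed
  have "coboundary G M act (Suc n) (coboundary G M act n f) gs
    = (\<Oplus>j\<in>{..Suc (Suc n)}. \<Oplus>i\<in>{..Suc n}. S i j)"
    unfolding coboundary_apply[OF df gs]
  proof (rule finsum_cong')
    fix j assume "j \<in> {..Suc (Suc n)}"
    then have j: "j \<le> Suc (Suc n)" by simp
    interpret a: abelian_group_hom M M "\<lambda>x. add_pow M ((-1::int) ^ j) (act (face_coeff G j gs) x)"
      using G.face_coeff_closed[OF gs]
      by (intro abelian_group_homI')
        (auto simp: M.abelian_group_axioms act_closed act_add add.int_pow_distrib)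
    have "face_term j (coboundary G M act n f) gs
      = add_pow M ((-1::int) ^ j) (act (face_coeff G j gs) (\<Oplus>i\<in>{..Suc n}. face_term i f (face G j gs)))"
      by (simp add: face_term_def[of j] coboundary_apply[OF f G.face_tuples[OF gs j]])
    also have "\<dots> = (\<Oplus>i\<in>{..Suc n}. S i j)"
      unfolding S_def using face_term_closed[OF f G.face_tuples[OF gs j]]
      by (intro a.hom_finsum) auto
    finally show "face_term j (coboundary G M act n f) gs = (\<Oplus>i\<in>{..Suc n}. S i j)" .
  qed (use cl in \<open>auto intro!: finsum_closed\<close>)
  also have "\<dots> = \<zero>"
  proof (rule double_sum_cancel)
    fix i j :: nat assume ij: "i < j" "j \<le> Suc (Suc n)"
    obtain k where k: "j = Suc k" using ij by (cases j) auto
    have "f (face G k (face G i gs)) \<in> carrier M"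
      using ij k cochainsD(2)[OF f] G.face_tuples G.face_tuples[OF gs] by simp
    moreover have "face_coeff G i gs \<in> carrier G" "face_coeff G k (face G i gs) \<in> carrier G"
      using G.face_coeff_closed gs G.face_tuples[OF gs, of i] ij by auto
    ultimately show "S i j = \<ominus> S (j - 1) i"
      using ij k len G.face_face[OF sub, of i j] G.face_coeff_face[OF sub, of i j]
      by (simp add: S add.int_pow_neg act_closed add.commute)
  qed (use cl in auto)
  finally show "coboundary G M act (Suc n) (coboundary G M act n f) gs
    = \<zero>\<^bsub>cochains G M (Suc (Suc n))\<^esub> gs"
    by (simp add: cochains_zero_apply[OF gs])
qed (simp_all add: f coboundary_closed cochains_abelian_group cochains_zero_closed)

end

section \<open>The order of G annihilates cohomology in positive degrees\<close>

context G_module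
begin

text \<open>Summing the cocycle identity over its last variable shows that \<open>\<Sum>\<^sub>x z(\<dots>, x)\<close> is, up to
  sign, a primitive of \<open>|G| z\<close>.\<close>

lemma order_smult_cocycle_is_coboundary:
  assumes fin: "finite (carrier G)"
    and z: "z \<in> carrier (cochains G M (Suc n))"
    and dz: "coboundary G M act (Suc n) z = \<zero>\<^bsub>cochains G M (Suc (Suc n))\<^esub>"
  obtains s where "s \<in> carrier (cochains G M n)"
    "coboundary G M act n s = add_pow (cochains G M (Suc n)) (order G) z"
proof -
  define s where "s = (\<lambda>gs\<in>tuples G n. \<Oplus>x\<in>carrier G. z (gs @ [x]))"
  have app: "gs @ [x] \<in> tuples G (Suc k)" if "gs \<in> tuples G k" "x \<in> carrier G" for gs x k
    using that by (auto simp: tuples_def)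
  have zc: "z (gs @ [x]) \<in> carrier M" if "gs \<in> tuples G n" "x \<in> carrier G" for gs x
    using cochainsD(2)[OF z app[OF that]] .
  have s: "s \<in> carrier (cochains G M n)"
  proof (rule cochainsI)
    fix gs assume gs: "gs \<in> tuples G n"
    show "s gs \<in> carrier M" using zc[OF gs] gs by (auto simp: s_def intro!: finsum_closed)
    assume "\<one>\<^bsub>G\<^esub> \<in> set gs"
    then show "s gs = \<zero>"
      using cochainsD(3)[OF z app[OF gs]] gs by (auto simp: s_def intro!: add.finprod_one_eqI)
  qed (simp add: s_def)
  \<comment> \<open>This is the cocycle identity at \<open>gs @ [x]\<close>, summed over x. The
    faces up to \<open>Suc n\<close> yield the coboundary of s, and the top face yields |G| z up to
    sign.\<close>
  have ds: "coboundary G M act n s gs \<oplus> add_pow M ((-1::int) ^ n) (add_pow M (order G) (z gs)) = \<zero>"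
    if gs: "gs \<in> tuples G (Suc n)" for gs
  proof -
    have len: "length gs = Suc n" and ne: "gs \<noteq> []" and sub: "set gs \<subseteq> carrier G"
      using gs by (auto simp: tuples_def)
    note zgs = cochainsD(2)[OF z gs]
    note cl = face_term_closed[OF z app[OF gs]]
    have low: "(\<Oplus>x\<in>carrier G. face_term i z (gs @ [x])) = face_term i s gs" if i: "i \<le> Suc n" for i
    proof -
      note fi = G.face_tuples[OF gs i]
      have ci: "face_coeff G i gs \<in> carrier G" using G.face_coeff_closed[OF gs] .
      interpret a: abelian_group_hom M M "\<lambda>x. add_pow M ((-1::int) ^ i) (act (face_coeff G i gs) x)"
        using ci by (intro abelian_group_homI')
          (auto simp: M.abelian_group_axioms act_closed act_add add.int_pow_distrib)
      have "(\<Oplus>x\<in>carrier G. z (face G i (gs @ [x]))) = s (face G i gs)"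
      proof (cases "i = Suc n")
        case True
        have bl: "butlast gs \<in> tuples G n" and la: "last gs \<in> carrier G"
          using fi True face_last[OF ne, of G] len sub ne by auto
        \<comment> \<open>Left multiplication by the last entry permutes G, so summing over x undoes
          the merge.\<close>
        have "(\<Oplus>x\<in>carrier G. z (butlast gs @ [last gs \<otimes>\<^bsub>G\<^esub> x]))
            = (\<Oplus>x\<in>(\<lambda>x. last gs \<otimes>\<^bsub>G\<^esub> x) ` carrier G. z (butlast gs @ [x]))"
          using zc[OF bl] la G.surj_const_mult[OF la] G.inj_on_cmult[OF la]
          by (intro finsum_reindex[symmetric]) auto
        then show ?thesis
          using bl True face_append_last[OF ne, of G] face_last[OF ne, of G] len G.surj_const_mult[OF la]
          by (simp add: s_def)
      next
        case False
        then have "face G i (gs @ [x]) = face G i gs @ [x]" for x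
          using i len ne face_append_singleton[of i gs G x] by (cases i) auto
        then show ?thesis using fi by (simp add: s_def)
      qed
      moreover have "face_coeff G i (gs @ [x]) = face_coeff G i gs" for x
        using ne by (simp add: face_coeff_def)
      moreover have "z (face G i (gs @ [x])) \<in> carrier M" if "x \<in> carrier G" for x
        using cochainsD(2)[OF z G.face_tuples[OF app[OF gs that], of i]] i by simp
      ultimately show ?thesis
        using a.hom_finsum[of "\<lambda>x. z (face G i (gs @ [x]))" "carrier G"] by (simp add: face_term_def Pi_def)
    qed
    have top: "(\<Oplus>x\<in>carrier G. face_term (Suc (Suc n)) z (gs @ [x]))
      = add_pow M ((-1::int) ^ n) (add_pow M (order G) (z gs))"
    proof -
      \<comment> \<open>The top face forgets x, so all |G| summands are equal; the sign (-1)^(n+2)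
        is (-1)^n.\<close>
      have "(\<Oplus>x\<in>carrier G. face_term (Suc (Suc n)) z (gs @ [x]))
         = (\<Oplus>x\<in>carrier G. add_pow M ((-1::int) ^ n) (z gs))"
        using zgs face_last[of "gs @ [x]" G for x] len
        by (intro finsum_cong') (auto simp: face_term_def face_coeff_def act_one)
      moreover have "abelian_group_hom M M (\<lambda>x. add_pow M ((-1::int) ^ n) x)"
        by (intro abelian_group_homI') (auto simp: M.abelian_group_axioms add.int_pow_distrib)
      ultimately show ?thesis
        using zgs by (simp add: add.finprod_const order_def abelian_group_hom.hom_add_pow_nat)
    qed
    have "\<zero> = (\<Oplus>x\<in>carrier G. \<Oplus>i\<in>{..Suc (Suc n)}. face_term i z (gs @ [x]))"
      using coboundary_apply[OF z app[OF gs]] dz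
      by (intro add.finprod_one_eqI[symmetric]) (auto simp: cochains_zero_apply app[OF gs])
    also have "\<dots> = (\<Oplus>i\<in>{..Suc (Suc n)}. \<Oplus>x\<in>carrier G. face_term i z (gs @ [x]))"
      using cl by (intro finsum_swap) auto
    also have "\<dots> = (\<Oplus>x\<in>carrier G. face_term (Suc (Suc n)) z (gs @ [x])) \<oplus>
        (\<Oplus>i\<in>{..Suc n}. \<Oplus>x\<in>carrier G. face_term i z (gs @ [x]))"
      using cl by (intro finsum_Suc) (auto intro!: finsum_closed)
    also have "(\<Oplus>i\<in>{..Suc n}. \<Oplus>x\<in>carrier G. face_term i z (gs @ [x])) = coboundary G M act n s gs"
      unfolding coboundary_apply[OF s gs] using low face_term_closed[OF s gs]
      by (intro finsum_cong') auto
    finally show ?thesis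
      unfolding top using zgs cochainsD(2)[OF coboundary_closed[OF s] gs] by (simp add: a_comm)
  qed
  interpret D: abelian_group_hom "cochains G M n" "cochains G M (Suc n)" "coboundary G M act n"
    by (rule coboundary_hom)
  have kz: "add_pow (cochains G M (Suc n)) (order G) z \<in> carrier (cochains G M (Suc n))"
    using z by simp
  show ?thesis
  \<comment> \<open>By \<open>ds\<close> the primitive of |G| z is -s for even n and s for odd
    n.\<close>
  proof (cases "even n")
    case True
    have "coboundary G M act n (\<ominus>\<^bsub>cochains G M n\<^esub> s) = add_pow (cochains G M (Suc n)) (order G) z"
    proof (rule cochains_eqI)
      fix gs assume gs: "gs \<in> tuples G (Suc n)"
      have "\<ominus> coboundary G M act n s gs = add_pow M (order G) (z gs)"
        using ds[OF gs] True cochainsD(2)[OF z gs] cochainsD(2)[OF coboundary_closed[OF s] gs]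
        by (intro minus_equality) (simp_all add: a_comm)
      then show "coboundary G M act n (\<ominus>\<^bsub>cochains G M n\<^esub> s) gs = add_pow (cochains G M (Suc n)) (order G) z gs"
        using s gs by (simp add: cochains_minus_apply cochains_add_pow_apply coboundary_closed)
    qed (use s kz in \<open>auto simp: coboundary_closed\<close>)
    then show ?thesis using that[of "\<ominus>\<^bsub>cochains G M n\<^esub> s"] s by simp
  next
    case False
    have "coboundary G M act n s = add_pow (cochains G M (Suc n)) (order G) z"
    proof (rule cochains_eqI)
      fix gs assume gs: "gs \<in> tuples G (Suc n)"
      have "\<ominus> (\<ominus> add_pow M (order G) (z gs)) = coboundary G M act n s gs"
        using ds[OF gs] False cochainsD(2)[OF z gs] cochainsD(2)[OF coboundary_closed[OF s] gs]
        by (intro minus_equality) (simp_all add: add.int_pow_neg)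
      then show "coboundary G M act n s gs = add_pow (cochains G M (Suc n)) (order G) z gs"
        using cochainsD(2)[OF z gs] gs by (simp add: cochains_add_pow_apply)
    qed (use s kz in \<open>auto simp: coboundary_closed\<close>)
    then show ?thesis using that[OF s] by simp
  qed
qed

section \<open>Cocycles and cohomology classes\<close>

lemma cocycles_iff:
  "z \<in> cocycles G M act n \<longleftrightarrow>
    z \<in> carrier (cochains G M n) \<and> coboundary G M act n z = \<zero>\<^bsub>cochains G M (Suc n)\<^esub>"
  by (simp add: cocycles_def a_kernel_def')

lemma mem_coho_class_iff:
  assumes "z \<in> carrier (cochains G M (Suc n))"
  shows "f \<in> coho_class G M act (Suc n) z \<longleftrightarrow>
    (\<exists>u \<in> carrier (cochains G M n). f = z \<oplus>\<^bsub>cochains G M (Suc n)\<^esub> coboundary G M act n u)"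
proof -
  interpret C: abelian_group "cochains G M (Suc n)" by (rule cochains_abelian_group)
  show ?thesis
    using assms coboundary_closed
    by (auto simp: coho_class_def coboundaries_def a_r_coset_def' C.a_comm)
qed

lemma coboundaries_subgroup:
  "subgroup (coboundaries G M act (Suc n)) (add_monoid (cochains G M (Suc n)))"
proof -
  interpret D: abelian_group_hom "cochains G M n" "cochains G M (Suc n)" "coboundary G M act n"
    by (rule coboundary_hom)
  show ?thesis
    using group_hom.img_is_subgroup[OF D.a_group_hom] by (simp add: coboundaries_def)
qed

lemma coho_class_eq_iff:
  assumes "z \<in> carrier (cochains G M (Suc n))" "z' \<in> carrier (cochains G M (Suc n))"
  shows "coho_class G M act (Suc n) z = coho_class G M act (Suc n) z' \<longleftrightarrow>
    (\<exists>u \<in> carrier (cochains G M n). z' = z \<oplus>\<^bsub>cochains G M (Suc n)\<^esub> coboundary G M act n u)"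
proof -
  interpret C: abelian_group "cochains G M (Suc n)" by (rule cochains_abelian_group)
  interpret B: abelian_subgroup "coboundaries G M act (Suc n)" "cochains G M (Suc n)"
    using coboundaries_subgroup by (intro abelian_subgroupI3 additive_subgroupI C.abelian_group_axioms)
  show ?thesis
    using B.a_rcos_self[OF assms(2)] B.a_repr_independence'[OF _ assms(1), of z']
    unfolding mem_coho_class_iff[OF assms(1), symmetric] by (auto simp: coho_class_def)
qed

lemma carrier_cohomology:
  "carrier (cohomology G M act n) = coho_class G M act n ` cocycles G M act n"
  by (auto simp: cohomology_def quot_module_def coho_class_def A_RCOSETS_def' a_r_coset_def')

end

section \<open>Functoriality in the coefficients\<close>

locale G_module_hom = A: G_module A G actA + B: G_module B G actB + abelian_group_hom A B \<phi>
  for A :: "('r, 'a, 'c) module_scheme" and G :: "('g, 'd) monoid_scheme" and actA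
    and B :: "('s, 'b, 'e) module_scheme" and actB and \<phi> +
  assumes equivariant: "\<lbrakk>g \<in> carrier G; x \<in> carrier A\<rbrakk> \<Longrightarrow> \<phi> (actA g x) = actB g (\<phi> x)"
begin

lemma map_cochain_closed:
  "f \<in> carrier (cochains G A n) \<Longrightarrow> compose (tuples G n) \<phi> f \<in> carrier (cochains G B n)"
  by (rule B.cochainsI) (auto simp: compose_def A.cochainsD)

lemma map_cochain_hom:
  "abelian_group_hom (cochains G A n) (cochains G B n) (compose (tuples G n) \<phi>)"
  by (rule abelian_group_homI')
    (auto intro!: B.cochains_eqI[where n = n] A.cochains_abelian_group B.cochains_abelian_group
      map_cochain_closed[unfolded compose_def] A.cochains_add_closed B.cochains_add_closed
      simp: compose_def A.cochains_add_apply B.cochains_add_apply A.cochainsD)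

lemma coboundary_map_cochain:
  assumes f: "f \<in> carrier (cochains G A n)"
  shows "coboundary G B actB n (compose (tuples G n) \<phi> f)
    = compose (tuples G (Suc n)) \<phi> (coboundary G A actA n f)"
proof (rule B.cochains_eqI)
  fix gs assume gs: "gs \<in> tuples G (Suc n)"
  have "B.face_term i (compose (tuples G n) \<phi> f) gs = \<phi> (A.face_term i f gs)" if "i \<le> Suc n" for i
  proof -
    have "f (face G i gs) \<in> carrier A"
      using A.cochainsD(2)[OF f A.G.face_tuples[OF gs that]] .
    then show ?thesis
      using A.G.face_coeff_closed[OF gs] A.G.face_tuples[OF gs that]
      by (simp add: A.face_term_def B.face_term_def compose_def hom_add_pow_int equivariant A.act_closed)
  qed
  then have "(\<Oplus>\<^bsub>B\<^esub>i\<in>{..Suc n}. B.face_term i (compose (tuples G n) \<phi> f) gs)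
    = (\<Oplus>\<^bsub>B\<^esub>i\<in>{..Suc n}. \<phi> (A.face_term i f gs))"
    using A.face_term_closed[OF f gs] by (intro B.finsum_cong') auto
  also have "\<dots> = \<phi> (\<Oplus>\<^bsub>A\<^esub>i\<in>{..Suc n}. A.face_term i f gs)"
    using A.face_term_closed[OF f gs] by (intro hom_finsum[symmetric]) auto
  finally show "coboundary G B actB n (compose (tuples G n) \<phi> f) gs
    = compose (tuples G (Suc n)) \<phi> (coboundary G A actA n f) gs"
    using gs by (simp add: B.coboundary_apply A.coboundary_apply map_cochain_closed f compose_def[of "tuples G (Suc n)"])
qed (simp_all add: f map_cochain_closed A.coboundary_closed B.coboundary_closed)

text \<open>\<open>coho_map\<close> is a union over all representatives of the class. They all
  contribute the same class because \<open>\<phi>\<close> carries coboundaries to coboundaries, and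
  z itself is one of them.\<close>

lemma coho_map_coho_class:
  assumes z: "z \<in> carrier (cochains G A (Suc n))"
  shows "coho_map G B actB (Suc n) \<phi> (coho_class G A actA (Suc n) z)
    = coho_class G B actB (Suc n) (compose (tuples G (Suc n)) \<phi> z)"
proof -
  interpret P: abelian_group_hom "cochains G A (Suc n)" "cochains G B (Suc n)" "compose (tuples G (Suc n)) \<phi>"
    by (rule map_cochain_hom)
  interpret C: abelian_group "cochains G A (Suc n)" by (rule A.cochains_abelian_group)
  have "coho_class G B actB (Suc n) (compose (tuples G (Suc n)) \<phi> f)
      = coho_class G B actB (Suc n) (compose (tuples G (Suc n)) \<phi> z)"
    if f: "f \<in> coho_class G A actA (Suc n) z" for f
  proof -
    obtain u where u: "u \<in> carrier (cochains G A n)"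
      "f = z \<oplus>\<^bsub>cochains G A (Suc n)\<^esub> coboundary G A actA n u"
      using f unfolding A.mem_coho_class_iff[OF z] by blast
    have "compose (tuples G (Suc n)) \<phi> f = compose (tuples G (Suc n)) \<phi> z
       \<oplus>\<^bsub>cochains G B (Suc n)\<^esub> coboundary G B actB n (compose (tuples G n) \<phi> u)"
      using u z by (simp add: A.coboundary_closed coboundary_map_cochain)
    then show ?thesis
      using u z map_cochain_closed[OF u(1)] map_cochain_closed[OF z]
      by (intro B.coho_class_eq_iff[THEN iffD2, symmetric])
        (auto simp: map_cochain_closed A.coboundary_closed B.coboundary_closed
            intro!: A.cochains_add_closed B.cochains_add_closed)
  qed
  moreover have "z \<in> coho_class G A actA (Suc n) z"
    unfolding A.mem_coho_class_iff[OF z]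
    using A.cochains_zero_closed abelian_group_hom.hom_zero[OF A.coboundary_hom, of n] z
    by (intro bexI[of _ "\<zero>\<^bsub>cochains G A n\<^esub>"]) auto
  ultimately show ?thesis
    unfolding coho_map_def coset_map_def coho_class_def[of _ B, symmetric] by blast
qed

end

section \<open>Quotient modules and lifts of cochains\<close>

context G_module
begin

lemma quot_G_module_hom:
  assumes H: "abelian_subgroup H M" and actH: "\<And>g h. g \<in> carrier G \<Longrightarrow> h \<in> H \<Longrightarrow> act g h \<in> H"
  shows "G_module_hom M G act (quot_module M H) (quot_act M H act) (\<lambda>x. H +> x)"
proof -
  interpret H: abelian_subgroup H M by (rule H)
  have Q: "abelian_group (quot_module M H)" using H by (rule quot_module_abelian_group)
  have car: "carrier (quot_module M H) = (\<lambda>x. H +> x) ` carrier M"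
    by (auto simp: quot_module_def A_RCOSETS_def')
  have add: "(H +> x) \<oplus>\<^bsub>quot_module M H\<^esub> (H +> y) = H +> (x \<oplus> y)"
    if "x \<in> carrier M" "y \<in> carrier M" for x y
    using H.a_rcos_sum that by (simp add: quot_module_def)
  have act: "quot_act M H act g (H +> x) = H +> act g x" if "g \<in> carrier G" "x \<in> carrier M" for g x
    unfolding quot_act_def using that by (intro coset_map_coset[OF H H act_hom]) (auto intro: actH)
  have "abelian_group_hom M (quot_module M H) (\<lambda>x. H +> x)"
    by (rule abelian_group_homI') (auto simp: M.abelian_group_axioms Q car add)
  moreover have "G_module (quot_module M H) G (quot_act M H act)"
    by (intro G_module.intro G_module_axioms.intro Q G.group_axioms)
      (auto simp: car act act_closed act_one act_mult act_add add)
  ultimately show ?thesis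
    by (intro G_module_hom.intro G_module_hom_axioms.intro G_module_axioms) (auto simp: act)
qed

lemma lift_cochain:
  assumes "abelian_subgroup H M"
    and c: "c \<in> carrier (cochains G (quot_module M H) n)"
  obtains f where "f \<in> carrier (cochains G M n)" "c = compose (tuples G n) (\<lambda>x. H +> x) f"
proof -
  interpret H: abelian_subgroup H M by fact
  \<comment> \<open>On tuples with a trivial entry any element of H would represent the value, but
    the lift is normalized only if 0 is chosen.\<close>
  have "\<exists>x \<in> carrier M. c gs = H +> x \<and> (\<one>\<^bsub>G\<^esub> \<in> set gs \<longrightarrow> x = \<zero>)" if gs: "gs \<in> tuples G n" for gs
  proof (cases "\<one>\<^bsub>G\<^esub> \<in> set gs")
    case True
    then have "c gs = H" using c gs by (auto simp: cochains_def quot_module_def)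
    then show ?thesis using H.a_subset by (intro bexI[of _ \<zero>]) auto
  next
    case False
    have "c gs \<in> carrier (quot_module M H)" using c gs by (auto simp: cochains_def)
    then show ?thesis using False by (auto simp: quot_module_def A_RCOSETS_def')
  qed
  then obtain f where f: "\<And>gs. gs \<in> tuples G n \<Longrightarrow>
      f gs \<in> carrier M \<and> c gs = H +> f gs \<and> (\<one>\<^bsub>G\<^esub> \<in> set gs \<longrightarrow> f gs = \<zero>)"
    by metis
  show ?thesis
  proof
    show "restrict f (tuples G n) \<in> carrier (cochains G M n)" using f by (intro cochainsI) auto
    have "c \<in> extensional (tuples G n)" using c by (auto simp: cochains_def PiE_def)
    then show "c = compose (tuples G n) (\<lambda>x. H +> x) (restrict f (tuples G n))"
      using f by (intro extensionalityI[of _ "tuples G n"]) (auto simp: compose_def)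
  qed
qed

end

section \<open>Reduction modulo powers of p\<close>

locale p_torsion_free_submodule = G_module M G act
  for M :: "('r, 'a, 'c) module_scheme" (structure) and G :: "('g, 'd) monoid_scheme" and act +
  fixes N :: "'a set" and p m :: nat
  assumes N_subgroup: "additive_subgroup N M"
    and N_act: "\<lbrakk>g \<in> carrier G; x \<in> N\<rbrakk> \<Longrightarrow> act g x \<in> N"
    and torsion_free: "\<lbrakk>x \<in> N; add_pow M p x = \<zero>\<rbrakk> \<Longrightarrow> x = \<zero>"
    and finite_G: "finite (carrier G)"
    and order_G: "order G = p ^ m"
begin

sublocale N: abelian_subgroup N M
  using N_subgroup M.abelian_group_axioms by (rule abelian_subgroupI3)

lemma add_pow_N: "x \<in> N \<Longrightarrow> add_pow M (k::nat) x \<in> N"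
  by (induction k) auto

lemma power_torsion_free: "\<lbrakk>x \<in> N; add_pow M (p ^ k) x = \<zero>\<rbrakk> \<Longrightarrow> x = \<zero>"
proof (induction k)
  case (Suc k)
  then have "add_pow M p (add_pow M (p ^ k) x) = \<zero>"
    by (simp add: add.nat_pow_pow mult.commute)
  then show ?case using Suc torsion_free[OF add_pow_N] by blast
qed simp

lemma nat_multiples_abelian_subgroup: "abelian_subgroup (nat_multiples M k N) M"
proof -
  interpret P: abelian_group_hom M M "\<lambda>x. add_pow M k x" by (rule add_pow_nat_hom)
  have "subgroup (nat_multiples M k N) (add_monoid M)"
    unfolding nat_multiples_def by (rule group_hom.subgroup_img_is_subgroup[OF P.a_group_hom N.a_subgroup])
  then show ?thesis
    by (intro abelian_subgroupI3 additive_subgroupI M.abelian_group_axioms)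
qed

lemma pro_G_module_hom:
  "G_module_hom M G act (quot_pr M N p r) (quot_pr_act M N p r act) (pro M N p r)"
proof -
  have "act g h \<in> nat_multiples M k N" if "g \<in> carrier G" "h \<in> nat_multiples M k N" for g h k
    using that N_act abelian_group_hom.hom_add_pow_nat[OF act_hom]
    by (auto simp: nat_multiples_def)
  from quot_G_module_hom[OF nat_multiples_abelian_subgroup this]
  show ?thesis
    by (simp add: quot_pr_def quot_pr_act_def[abs_def] pro_def[abs_def])
qed

lemma pro_eq_iff:
  assumes "x \<in> carrier M" "y \<in> carrier M"
  shows "pro M N p r x = pro M N p r y \<longleftrightarrow> (\<exists>w\<in>N. y = x \<oplus> add_pow M (p ^ r) w)"
proof -
  interpret H: abelian_subgroup "nat_multiples M (p ^ r) N" M by (rule nat_multiples_abelian_subgroup)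
  have "pro M N p r x = pro M N p r y \<longleftrightarrow> y \<in> nat_multiples M (p ^ r) N +> x"
    unfolding pro_def using assms H.a_rcos_self H.a_repr_independence' by metis
  also have "\<dots> \<longleftrightarrow> (\<exists>w\<in>N. y = x \<oplus> add_pow M (p ^ r) w)"
    using assms by (auto simp: a_r_coset_def' nat_multiples_def a_comm)
  finally show ?thesis .
qed

text \<open>Holds because p^r N is contained in p^s N: p^r x = p^s (p^(r-s) x).\<close>

lemma quot_proj_pro:
  assumes "s \<le> r" "x \<in> carrier M"
  shows "quot_proj M N p s (pro M N p r x) = pro M N p s x"
proof -
  have "h \<in> nat_multiples M (p ^ s) N" if h: "h \<in> nat_multiples M (p ^ r) N" for h
  proof -
    obtain x where x: "x \<in> N" "h = add_pow M (p ^ r) x" using h by (auto simp: nat_multiples_def)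
    then have "h = add_pow M (p ^ s) (add_pow M (p ^ (r - s)) x)"
      using assms(1) by (simp add: add.nat_pow_pow mult.commute flip: power_add)
    then show ?thesis using add_pow_N[OF x(1)] unfolding nat_multiples_def by blast
  qed
  moreover have "abelian_group_hom M M (\<lambda>x. x)"
    by (rule abelian_group_homI') (auto simp: M.abelian_group_axioms)
  ultimately show ?thesis
    unfolding quot_proj_def pro_def using assms(2)
    by (intro coset_map_coset nat_multiples_abelian_subgroup) auto
qed

lemma carrier_quot_pr: "carrier (quot_pr M N p r) = pro M N p r ` carrier M"
  by (auto simp: quot_pr_def quot_module_def A_RCOSETS_def' pro_def)

lemma quot_proj_G_module_hom:
  assumes "s \<le> r"
  shows "G_module_hom (quot_pr M N p r) G (quot_pr_act M N p r act)
    (quot_pr M N p s) (quot_pr_act M N p s act) (quot_proj M N p s)"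
proof -
  interpret r: G_module_hom M G act "quot_pr M N p r" "quot_pr_act M N p r act" "pro M N p r"
    by (rule pro_G_module_hom)
  interpret s: G_module_hom M G act "quot_pr M N p s" "quot_pr_act M N p s act" "pro M N p s"
    by (rule pro_G_module_hom)
  have "abelian_group_hom (quot_pr M N p r) (quot_pr M N p s) (quot_proj M N p s)"
    by (rule abelian_group_homI')
      (auto simp: carrier_quot_pr quot_proj_pro assms r.B.M.abelian_group_axioms s.B.M.abelian_group_axioms
        simp flip: r.hom_add s.hom_add)
  then show ?thesis
    by (intro G_module_hom.intro G_module_hom_axioms.intro r.B.G_module_axioms s.B.G_module_axioms)
      (auto simp: carrier_quot_pr quot_proj_pro assms act_closed simp flip: r.equivariant s.equivariant)
qed

section \<open>Cochains with values in N\<close>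

lemma sub_G_module_hom: "G_module_hom (sub_mod M N) G act M act (\<lambda>x. x)"
proof -
  have "abelian_group (sub_mod M N)"
    by (rule abelian_groupI)
      (auto simp: sub_mod_def a_ac l_neg r_neg intro!: bexI[of _ "\<ominus> x" for x])
  moreover from this have "abelian_group_hom (sub_mod M N) M (\<lambda>x. x)"
    by (intro abelian_group_homI') (auto simp: sub_mod_def M.abelian_group_axioms)
  moreover have "G_module_axioms (sub_mod M N) G act"
    by (intro G_module_axioms.intro) (auto simp: sub_mod_def N_act act_one act_mult act_add)
  ultimately show ?thesis
    by (intro G_module_hom.intro G_module_hom_axioms.intro G_module.intro G_module_axioms G.group_axioms) auto
qed

sublocale sub: G_module_hom "sub_mod M N" G act M act "\<lambda>x. x"
  by (rule sub_G_module_hom)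

lemma sub_cochains_iff:
  "f \<in> carrier (cochains G (sub_mod M N) n) \<longleftrightarrow>
    f \<in> carrier (cochains G M n) \<and> (\<forall>gs\<in>tuples G n. f gs \<in> N)"
  by (auto simp: cochains_def sub_mod_def PiE_def Pi_iff)

lemma sub_cochains_add [simp]: "ring.add (cochains G (sub_mod M N) n) = ring.add (cochains G M n)"
  and sub_cochains_zero [simp]: "ring.zero (cochains G (sub_mod M N) n) = ring.zero (cochains G M n)"
  by (simp_all add: cochains_def sub_mod_def)

lemma sub_cochains_add_pow:
  "add_pow (cochains G (sub_mod M N) n) (k::nat) f = add_pow (cochains G M n) k f"
  by (induction k) (simp_all add: add_pow_def nat_pow_def)

text \<open>Naturality of the coboundary under the inclusion of N. Composition with the identity
  leaves a cochain unchanged since cochains are extensional.\<close>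

lemma coboundary_sub:
  assumes "f \<in> carrier (cochains G (sub_mod M N) n)"
  shows "coboundary G (sub_mod M N) act n f = coboundary G M act n f"
proof -
  have c: "compose (tuples G k) (\<lambda>x. x) h = h" if "h \<in> carrier (cochains G (sub_mod M N) k)" for h k
    using that by (intro extensionalityI[of _ "tuples G k"]) (auto simp: compose_def cochains_def PiE_def)
  show ?thesis
    using sub.coboundary_map_cochain[OF assms] c[OF assms] c[OF sub.A.coboundary_closed[OF assms]] by simp
qed

abbreviation sub_cochains (\<open>CN\<close>) where
  "CN n \<equiv> carrier (cochains G (sub_mod M N) n)"

abbreviation cobd (\<open>\<delta>\<close>) where
  "\<delta> n \<equiv> coboundary G M act n"

abbreviation power_mult where
  "power_mult r n f \<equiv> add_pow (cochains G M n) (p ^ r) f"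

abbreviation pro_cochain where
  "pro_cochain r n \<equiv> compose (tuples G n) (pro M N p r)"

lemma sub_cochains_subset: "w \<in> CN n \<Longrightarrow> w \<in> carrier (cochains G M n)"
  by (simp add: sub_cochains_iff)

lemma sub_cochains_add_closed:
  "\<lbrakk>w \<in> CN n; w' \<in> CN n\<rbrakk> \<Longrightarrow> w \<oplus>\<^bsub>cochains G M n\<^esub> w' \<in> CN n"
  using sub.A.cochains_add_closed[of w n w'] by simp

lemma sub_cochains_add_pow_closed: "w \<in> CN n \<Longrightarrow> add_pow (cochains G M n) (k::nat) w \<in> CN n"
proof -
  interpret CN: abelian_group "cochains G (sub_mod M N) n" by (rule sub.A.cochains_abelian_group)
  show "w \<in> CN n \<Longrightarrow> ?thesis"
    using CN.add.nat_pow_closed[of w k] by (simp add: sub_cochains_add_pow)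
qed

lemma coboundary_sub_closed: "w \<in> CN n \<Longrightarrow> \<delta> n w \<in> CN (Suc n)"
  using sub.A.coboundary_closed by (simp flip: coboundary_sub)

lemma power_mult_N_inj:
  assumes "x \<in> N" "y \<in> N" "add_pow M (p ^ r) x = add_pow M (p ^ r) y"
  shows "x = y"
proof -
  have "add_pow M (p ^ r) (x \<ominus> y) = \<zero>"
    using assms by (simp add: a_minus_def add.nat_pow_distrib add.nat_pow_inv r_neg)
  then have "x \<ominus> y = \<zero>"
    using power_torsion_free[of "x \<ominus> y"] assms by (simp add: a_minus_def)
  then show ?thesis
    using assms minus_equality[of x "\<ominus> y"] by (simp add: a_minus_def)
qed

lemma power_mult_inj:
  assumes "w \<in> CN n" "w' \<in> CN n" "power_mult r n w = power_mult r n w'"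
  shows "w = w'"
proof (rule cochains_eqI)
  fix gs assume gs: "gs \<in> tuples G n"
  then have "add_pow M (p ^ r) (w gs) = add_pow M (p ^ r) (w' gs)"
    using assms(3) by (metis cochains_add_pow_apply)
  then show "w gs = w' gs"
    using power_mult_N_inj assms(1,2) gs by (simp add: sub_cochains_iff)
qed (use assms in \<open>auto simp: sub_cochains_iff\<close>)

lemma power_mult_eq_zero:
  assumes "w \<in> CN n" "power_mult r n w = \<zero>\<^bsub>cochains G M n\<^esub>"
  shows "w = \<zero>\<^bsub>cochains G M n\<^esub>"
proof -
  interpret C: abelian_group "cochains G M n" by (rule cochains_abelian_group)
  show ?thesis
    using assms sub.A.cochains_zero_closed[of n] by (intro power_mult_inj[of w n _ r]) simp_all
qed

lemma coboundary_power_mult: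
  "f \<in> carrier (cochains G M n) \<Longrightarrow> \<delta> n (add_pow (cochains G M n) (k::nat) f)
    = add_pow (cochains G M (Suc n)) k (\<delta> n f)"
  by (rule abelian_group_hom.hom_add_pow_nat[OF coboundary_hom])

section \<open>Cochains and classes modulo p^r N\<close>

lemma pro_cochain_eq_iff:
  assumes f: "f \<in> carrier (cochains G M n)" and f': "f' \<in> carrier (cochains G M n)"
  shows "pro_cochain r n f = pro_cochain r n f' \<longleftrightarrow>
    (\<exists>w\<in>CN n. f' = f \<oplus>\<^bsub>cochains G M n\<^esub> power_mult r n w)"
proof
  assume eq: "pro_cochain r n f = pro_cochain r n f'"
  \<comment> \<open>The quotient w of the difference by p^r is built pointwise and set to 0 on
    tuples with a trivial entry, where f and f' both vanish, so that w is a normalized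
    cochain.\<close>
  have "\<exists>w\<in>N. f' gs = f gs \<oplus> add_pow M (p ^ r) w \<and> (\<one>\<^bsub>G\<^esub> \<in> set gs \<longrightarrow> w = \<zero>)"
    if gs: "gs \<in> tuples G n" for gs
  proof (cases "\<one>\<^bsub>G\<^esub> \<in> set gs")
    case True
    then show ?thesis using f f' gs by (intro bexI[of _ \<zero>]) (auto simp: cochainsD)
  next
    case False
    have "pro M N p r (f gs) = pro M N p r (f' gs)"
      using fun_cong[OF eq, of gs] gs by (simp add: compose_def)
    then show ?thesis using False pro_eq_iff f f' gs by (simp add: cochainsD)
  qed
  then obtain w where w: "\<And>gs. gs \<in> tuples G n \<Longrightarrow>
      w gs \<in> N \<and> f' gs = f gs \<oplus> add_pow M (p ^ r) (w gs) \<and> (\<one>\<^bsub>G\<^esub> \<in> set gs \<longrightarrow> w gs = \<zero>)"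
    by metis
  have wN: "restrict w (tuples G n) \<in> CN n"
    using w unfolding sub_cochains_iff by (auto intro!: cochainsI)
  interpret C: abelian_group "cochains G M n" by (rule cochains_abelian_group)
  have "f' = f \<oplus>\<^bsub>cochains G M n\<^esub> power_mult r n (restrict w (tuples G n))"
    using w f f' sub_cochains_subset[OF wN]
    by (intro cochains_eqI[where n = n]) (auto simp: cochains_add_apply cochains_add_pow_apply)
  then show "\<exists>w\<in>CN n. f' = f \<oplus>\<^bsub>cochains G M n\<^esub> power_mult r n w" using wN by blast
next
  assume "\<exists>w\<in>CN n. f' = f \<oplus>\<^bsub>cochains G M n\<^esub> power_mult r n w"
  then obtain w where w: "w \<in> CN n" "f' = f \<oplus>\<^bsub>cochains G M n\<^esub> power_mult r n w" by blast
  have "pro M N p r (f gs) = pro M N p r (f' gs)" if gs: "gs \<in> tuples G n" for gs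
    using w gs f f' cochainsD(2)[OF f gs] cochainsD(2)[OF f' gs]
    by (subst pro_eq_iff) (auto simp: cochains_add_apply cochains_add_pow_apply sub_cochains_iff)
  then show "pro_cochain r n f = pro_cochain r n f'"
    unfolding compose_def by (rule restrict_ext)
qed

lemma pro_cochain_lift:
  assumes "c \<in> carrier (cochains G (quot_pr M N p r) n)"
  obtains f where "f \<in> carrier (cochains G M n)" "c = pro_cochain r n f"
  using lift_cochain[OF nat_multiples_abelian_subgroup assms[unfolded quot_pr_def]]
  unfolding pro_def[abs_def] by blast

text \<open>The cocycle condition says that the coboundary of f and the zero cochain have the same
  reduction, so \<open>pro_cochain_eq_iff\<close> supplies h.\<close>

lemma pro_cochain_cocycle_iff:
  assumes f: "f \<in> carrier (cochains G M n)"
  shows "pro_cochain r n f \<in> cocycles G (quot_pr M N p r) (quot_pr_act M N p r act) n \<longleftrightarrow>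
    (\<exists>h\<in>CN (Suc n). \<delta> n f = power_mult r (Suc n) h)"
proof -
  interpret pr: G_module_hom M G act "quot_pr M N p r" "quot_pr_act M N p r act" "pro M N p r"
    by (rule pro_G_module_hom)
  interpret C: abelian_group "cochains G M (Suc n)" by (rule cochains_abelian_group)
  interpret P: abelian_group_hom "cochains G M (Suc n)" "cochains G (quot_pr M N p r) (Suc n)" "pro_cochain r (Suc n)"
    by (rule pr.map_cochain_hom)
  have "pro_cochain r n f \<in> cocycles G (quot_pr M N p r) (quot_pr_act M N p r act) n \<longleftrightarrow>
    pro_cochain r (Suc n) \<zero>\<^bsub>cochains G M (Suc n)\<^esub> = pro_cochain r (Suc n) (\<delta> n f)"
    using f by (auto simp: pr.B.cocycles_iff pr.map_cochain_closed pr.coboundary_map_cochain)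
  also have "\<dots> \<longleftrightarrow> (\<exists>h\<in>CN (Suc n). \<delta> n f = power_mult r (Suc n) h)"
    using f by (subst pro_cochain_eq_iff)
      (auto simp: coboundary_closed sub_cochains_subset intro!: bex_cong)
  finally show ?thesis .
qed

text \<open>A coboundary in the quotient is the reduction of the coboundary of a lift u. After
  adding it, the two cochains of M agree modulo p^r N, which leaves the term p^r w.\<close>

lemma coho_class_pro_eq_iff:
  assumes f: "f \<in> carrier (cochains G M (Suc n))" and f': "f' \<in> carrier (cochains G M (Suc n))"
  shows "coho_class G (quot_pr M N p r) (quot_pr_act M N p r act) (Suc n) (pro_cochain r (Suc n) f)
      = coho_class G (quot_pr M N p r) (quot_pr_act M N p r act) (Suc n) (pro_cochain r (Suc n) f')
    \<longleftrightarrow> (\<exists>u\<in>carrier (cochains G M n). \<exists>w\<in>CN (Suc n).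
      f' = f \<oplus>\<^bsub>cochains G M (Suc n)\<^esub> (\<delta> n u \<oplus>\<^bsub>cochains G M (Suc n)\<^esub> power_mult r (Suc n) w))"
    (is "?L \<longleftrightarrow> ?R")
proof -
  interpret pr: G_module_hom M G act "quot_pr M N p r" "quot_pr_act M N p r act" "pro M N p r"
    by (rule pro_G_module_hom)
  interpret C: abelian_group "cochains G M (Suc n)" by (rule cochains_abelian_group)
  interpret P: abelian_group_hom "cochains G M (Suc n)" "cochains G (quot_pr M N p r) (Suc n)" "pro_cochain r (Suc n)"
    by (rule pr.map_cochain_hom)
  have "?L \<longleftrightarrow> (\<exists>u\<in>carrier (cochains G (quot_pr M N p r) n). pro_cochain r (Suc n) f'
      = pro_cochain r (Suc n) f \<oplus>\<^bsub>cochains G (quot_pr M N p r) (Suc n)\<^esub>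
        coboundary G (quot_pr M N p r) (quot_pr_act M N p r act) n u)"
    using f f' by (intro pr.B.coho_class_eq_iff pr.map_cochain_closed)
  also have "\<dots> \<longleftrightarrow> (\<exists>u\<in>carrier (cochains G M n). pro_cochain r (Suc n) f'
      = pro_cochain r (Suc n) f \<oplus>\<^bsub>cochains G (quot_pr M N p r) (Suc n)\<^esub>
        coboundary G (quot_pr M N p r) (quot_pr_act M N p r act) n (pro_cochain r n u))"
    using pr.map_cochain_closed pro_cochain_lift by metis
  also have "\<dots> \<longleftrightarrow> (\<exists>u\<in>carrier (cochains G M n). pro_cochain r (Suc n) (f \<oplus>\<^bsub>cochains G M (Suc n)\<^esub> \<delta> n u)
      = pro_cochain r (Suc n) f')"
    using f by (intro bex_cong refl) (auto simp: pr.coboundary_map_cochain coboundary_closed)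
  also have "\<dots> \<longleftrightarrow> (\<exists>u\<in>carrier (cochains G M n). \<exists>w\<in>CN (Suc n).
      f' = (f \<oplus>\<^bsub>cochains G M (Suc n)\<^esub> \<delta> n u) \<oplus>\<^bsub>cochains G M (Suc n)\<^esub> power_mult r (Suc n) w)"
    using f f' by (intro bex_cong refl pro_cochain_eq_iff) (auto simp: coboundary_closed)
  also have "\<dots> \<longleftrightarrow> ?R"
    using f by (intro bex_cong refl) (auto simp: C.a_assoc coboundary_closed sub_cochains_subset)
  finally show ?thesis .
qed

section \<open>Multiplication by p^m makes cocycles of N coboundaries\<close>

lemma sub_cocycle_primitive:
  assumes "w \<in> CN (Suc n)" "\<delta> (Suc n) w = \<zero>\<^bsub>cochains G M (Suc (Suc n))\<^esub>"
  obtains v where "v \<in> CN n" "\<delta> n v = power_mult m (Suc n) w"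
proof -
  \<comment> \<open>The summation lemma is applied to N rather than to M, so that the primitive has
    values in N. For w = \<open>\<eta>\<close> it is the required \<open>\<sigma>\<close>.\<close>
  obtain v where "v \<in> CN n" "coboundary G (sub_mod M N) act n v
      = add_pow (cochains G (sub_mod M N) (Suc n)) (order G) w"
    using sub.A.order_smult_cocycle_is_coboundary[OF finite_G assms(1)] assms
    by (auto simp: coboundary_sub)
  then show ?thesis using that by (simp add: coboundary_sub sub_cochains_add_pow order_G)
qed

lemma sub_cocycle_power_mult_is_coboundary:
  assumes "w \<in> CN (Suc n)" "\<delta> (Suc n) w = \<zero>\<^bsub>cochains G M (Suc (Suc n))\<^esub>" and "m \<le> s"
  obtains v where "v \<in> CN n" "\<delta> n v = power_mult s (Suc n) w"
proof -
  interpret C: abelian_group "cochains G M (Suc n)" by (rule cochains_abelian_group)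
  obtain v where v: "v \<in> CN n" "\<delta> n v = power_mult m (Suc n) w"
    using sub_cocycle_primitive assms(1,2) by blast
  have "\<delta> n (power_mult (s - m) n v) = power_mult s (Suc n) w"
    using v assms by (simp add: coboundary_power_mult sub_cochains_subset C.add.nat_pow_pow flip: power_add)
  then show ?thesis using that v(1) sub_cochains_add_pow_closed by blast
qed

text \<open>Applying the coboundary once more gives p^r \<open>\<delta>\<close> h = 0, and p^r can
  be cancelled since \<open>\<delta>\<close> h has values in N.\<close>

lemma sub_cocycleI:
  assumes f: "f \<in> carrier (cochains G M n)" and h: "h \<in> CN (Suc n)" and df: "\<delta> n f = power_mult r (Suc n) h"
  shows "\<delta> (Suc n) h = \<zero>\<^bsub>cochains G M (Suc (Suc n))\<^esub>"
proof -
  interpret C: abelian_group "cochains G M (Suc (Suc n))" by (rule cochains_abelian_group)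
  have "power_mult r (Suc (Suc n)) (\<delta> (Suc n) h) = \<zero>\<^bsub>cochains G M (Suc (Suc n))\<^esub>"
    using coboundary_coboundary[OF f] h df by (simp add: coboundary_power_mult sub_cochains_subset)
  then show ?thesis by (rule power_mult_eq_zero[OF coboundary_sub_closed[OF h]])
qed

section \<open>Evaluation of the two components of \<open>Phi\<close>\<close>

lemma pro_coho_map_inj:
  assumes "m \<le> s"
  shows "inj_on (coho_map G (quot_pr M N p s) (quot_pr_act M N p s act) (Suc n) (pro M N p s))
    (carrier (cohomology G M act (Suc n)))"
proof (rule inj_onI)
  fix c c'
  let ?\<Phi> = "coho_map G (quot_pr M N p s) (quot_pr_act M N p s act) (Suc n) (pro M N p s)"
  interpret pr: G_module_hom M G act "quot_pr M N p s" "quot_pr_act M N p s act" "pro M N p s"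
    by (rule pro_G_module_hom)
  interpret C: abelian_group "cochains G M (Suc n)" by (rule cochains_abelian_group)
  interpret D: abelian_group_hom "cochains G M n" "cochains G M (Suc n)" "\<delta> n" by (rule coboundary_hom)
  interpret D': abelian_group_hom "cochains G M (Suc n)" "cochains G M (Suc (Suc n))" "\<delta> (Suc n)"
    by (rule coboundary_hom)
  assume "c \<in> carrier (cohomology G M act (Suc n))" "c' \<in> carrier (cohomology G M act (Suc n))"
    and eq: "?\<Phi> c = ?\<Phi> c'"
  then obtain z z' where z: "z \<in> carrier (cochains G M (Suc n))" "z' \<in> carrier (cochains G M (Suc n))"
    "\<delta> (Suc n) z = \<zero>\<^bsub>cochains G M (Suc (Suc n))\<^esub>" "\<delta> (Suc n) z' = \<zero>\<^bsub>cochains G M (Suc (Suc n))\<^esub>"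
    and c: "c = coho_class G M act (Suc n) z" "c' = coho_class G M act (Suc n) z'"
    by (auto simp: carrier_cohomology cocycles_iff)
  obtain u w where u: "u \<in> carrier (cochains G M n)" and w: "w \<in> CN (Suc n)"
    and z': "z' = z \<oplus>\<^bsub>cochains G M (Suc n)\<^esub> (\<delta> n u \<oplus>\<^bsub>cochains G M (Suc n)\<^esub> power_mult s (Suc n) w)"
    using eq z by (auto simp: c pr.coho_map_coho_class coho_class_pro_eq_iff)
  note wM = sub_cochains_subset[OF w]
  \<comment> \<open>Both z and z' are cocycles, so the coboundary of the error term p^s w must
    vanish. Cancelling p^s makes w a cocycle of N.\<close>
  have "power_mult s (Suc (Suc n)) (\<delta> (Suc n) w) = \<zero>\<^bsub>cochains G M (Suc (Suc n))\<^esub>"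
    using z(3,4) z(1) u wM coboundary_power_mult[OF wM] coboundary_coboundary[OF u] unfolding z' by simp
  then have "\<delta> (Suc n) w = \<zero>\<^bsub>cochains G M (Suc (Suc n))\<^esub>"
    by (rule power_mult_eq_zero[OF coboundary_sub_closed[OF w]])
  then obtain v where v: "v \<in> CN n" "\<delta> n v = power_mult s (Suc n) w"
    using sub_cocycle_power_mult_is_coboundary[OF w _ assms] by blast
  \<comment> \<open>As s >= m, the term p^s w is the coboundary of v and is absorbed into u.\<close>
  then have "z' = z \<oplus>\<^bsub>cochains G M (Suc n)\<^esub> \<delta> n (u \<oplus>\<^bsub>cochains G M n\<^esub> v)"
    using z' u sub_cochains_subset[OF v(1)] by simp
  then show "c = c'"
    unfolding c coho_class_eq_iff[OF z(1,2)]
    using u sub_cochains_subset[OF v(1)] cochains_add_closed by blast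
qed

text \<open>The definite description is resolved by showing that all admissible choices give one
  class. Two lifts f and f' differ by \<open>\<delta>\<close> u + p^r w; taking coboundaries and
  cancelling p^r in N gives h' = h + \<open>\<delta>\<close> w.\<close>

lemma connecting_hom_pro:
  assumes f: "f \<in> carrier (cochains G M (Suc n))" and h: "h \<in> CN (Suc (Suc n))"
    and df: "\<delta> (Suc n) f = power_mult r (Suc (Suc n)) h"
  shows "connecting_hom G (sub_mod M N) act M act (\<lambda>x. add_pow M (p ^ r) x) (pro M N p r) (Suc n)
      (coho_class G (quot_pr M N p r) (quot_pr_act M N p r act) (Suc n) (pro_cochain r (Suc n) f))
    = coho_class G (sub_mod M N) act (Suc (Suc n)) h"
proof -
  interpret pr: G_module_hom M G act "quot_pr M N p r" "quot_pr_act M N p r act" "pro M N p r"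
    by (rule pro_G_module_hom)
  interpret C: abelian_group "cochains G M (Suc n)" by (rule cochains_abelian_group)
  interpret C': abelian_group "cochains G M (Suc (Suc n))" by (rule cochains_abelian_group)
  interpret D: abelian_group_hom "cochains G M n" "cochains G M (Suc n)" "\<delta> n" by (rule coboundary_hom)
  interpret D': abelian_group_hom "cochains G M (Suc n)" "cochains G M (Suc (Suc n))" "\<delta> (Suc n)"
    by (rule coboundary_hom)
  interpret PW: abelian_group_hom "cochains G M (Suc (Suc n))" "cochains G M (Suc (Suc n))" "power_mult r (Suc (Suc n))"
    by (rule C'.add_pow_nat_hom)
  let ?c = "\<lambda>f. coho_class G (quot_pr M N p r) (quot_pr_act M N p r act) (Suc n) (pro_cochain r (Suc n) f)"
  \<comment> \<open>The injection of the exact sequence is multiplication by p^r, so composing with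
    it is \<open>power_mult\<close> on cochains of N.\<close>
  have \<iota>: "compose (tuples G (Suc (Suc n))) (\<lambda>x. add_pow M (p ^ r) x) h = power_mult r (Suc (Suc n)) h"
    if "h \<in> CN (Suc (Suc n))" for h
    using sub_cochains_subset[OF that] cochainsD(1)[of _ "Suc (Suc n)"]
    by (intro extensionalityI[of _ "tuples G (Suc (Suc n))"])
      (auto simp: compose_def cochains_add_pow_apply)
  have self: "pro_cochain r (Suc n) f \<in> ?c f"
    unfolding pr.B.mem_coho_class_iff[OF pr.map_cochain_closed[OF f]]
    using pr.B.cochains_zero_closed abelian_group_hom.hom_zero[OF pr.B.coboundary_hom, of n]
      abelian_monoid.r_zero[OF abelian_group.axioms(1)[OF pr.B.cochains_abelian_group] pr.map_cochain_closed[OF f]]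
    by (intro bexI[of _ "\<zero>\<^bsub>cochains G (quot_pr M N p r) n\<^esub>"]) auto
  show ?thesis
    unfolding connecting_hom_def
  proof (rule the_equality)
    have "h \<in> cocycles G (sub_mod M N) act (Suc (Suc n))"
      using h sub_cocycleI[OF f h df] by (simp add: sub.A.cocycles_iff coboundary_sub)
    then show "\<exists>f'\<in>carrier (cochains G M (Suc n)). \<exists>h'\<in>cocycles G (sub_mod M N) act (Suc n + 1).
        pro_cochain r (Suc n) f' \<in> ?c f \<and>
        \<delta> (Suc n) f' = compose (tuples G (Suc n + 1)) (\<lambda>x. add_pow M (p ^ r) x) h' \<and>
        coho_class G (sub_mod M N) act (Suc (Suc n)) h = coho_class G (sub_mod M N) act (Suc n + 1) h'"
      using f h df self by (intro bexI[of _ f] bexI[of _ h]) (auto simp: \<iota>)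
  next
    fix d
    assume "\<exists>f'\<in>carrier (cochains G M (Suc n)). \<exists>h'\<in>cocycles G (sub_mod M N) act (Suc n + 1).
        pro_cochain r (Suc n) f' \<in> ?c f \<and>
        \<delta> (Suc n) f' = compose (tuples G (Suc n + 1)) (\<lambda>x. add_pow M (p ^ r) x) h' \<and>
        d = coho_class G (sub_mod M N) act (Suc n + 1) h'"
    then obtain f' h' where f': "f' \<in> carrier (cochains G M (Suc n))" and h': "h' \<in> CN (Suc (Suc n))"
      and mem: "pro_cochain r (Suc n) f' \<in> ?c f"
      and df': "\<delta> (Suc n) f' = power_mult r (Suc (Suc n)) h'"
      and d: "d = coho_class G (sub_mod M N) act (Suc (Suc n)) h'"
      by (auto simp: \<iota> sub.A.cocycles_iff)
    have "?c f = ?c f'"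
      using mem pr.map_cochain_closed f f'
      by (simp add: pr.B.mem_coho_class_iff pr.B.coho_class_eq_iff)
    then obtain u w where u: "u \<in> carrier (cochains G M n)" and w: "w \<in> CN (Suc n)"
      and eq: "f' = f \<oplus>\<^bsub>cochains G M (Suc n)\<^esub> (\<delta> n u \<oplus>\<^bsub>cochains G M (Suc n)\<^esub> power_mult r (Suc n) w)"
      using f f' by (auto simp: coho_class_pro_eq_iff)
    note M = sub_cochains_subset[OF w] sub_cochains_subset[OF h] coboundary_closed[OF sub_cochains_subset[OF w]]
    have "power_mult r (Suc (Suc n)) h' = power_mult r (Suc (Suc n)) (h \<oplus>\<^bsub>cochains G M (Suc (Suc n))\<^esub> \<delta> (Suc n) w)"
      using df' f u M coboundary_power_mult[OF M(1)] coboundary_coboundary[OF u] df unfolding eq by simp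
    then have "h' = h \<oplus>\<^bsub>cochains G M (Suc (Suc n))\<^esub> \<delta> (Suc n) w"
      using h h' w by - (rule power_mult_inj, auto intro: sub_cochains_add_closed coboundary_sub_closed)
    then show "d = coho_class G (sub_mod M N) act (Suc (Suc n)) h"
      unfolding d using h h' w
      by (subst eq_commute, subst sub.A.coho_class_eq_iff) (auto simp: coboundary_sub)
  qed
qed

text \<open>The coboundary of f is p^(r-m) p^m h = p^r h, so h represents the connecting
  homomorphism. Modulo p^(r-m) N the cochains f and \<open>\<rho>\<close> agree, and injectivity of
  \<open>pro\<close> in degree r - m >= m makes \<open>inv_into\<close> return the class of
  \<open>\<rho>\<close>.\<close>

lemma Phi_pro:
  assumes "2 * m \<le> r" and \<rho>: "\<rho> \<in> carrier (cochains G M (Suc n))"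
    and d\<rho>: "\<delta> (Suc n) \<rho> = \<zero>\<^bsub>cochains G M (Suc (Suc n))\<^esub>"
    and \<sigma>: "\<sigma> \<in> CN (Suc n)" and h: "h \<in> CN (Suc (Suc n))"
    and d\<sigma>: "\<delta> (Suc n) \<sigma> = power_mult m (Suc (Suc n)) h"
  shows "Phi G M act N p m (Suc n) r
      (coho_class G (quot_pr M N p r) (quot_pr_act M N p r act) (Suc n)
        (pro_cochain r (Suc n) (\<rho> \<oplus>\<^bsub>cochains G M (Suc n)\<^esub> power_mult (r - m) (Suc n) \<sigma>)))
    = (coho_class G M act (Suc n) \<rho>, coho_class G (sub_mod M N) act (Suc (Suc n)) h)"
proof -
  define f where "f = \<rho> \<oplus>\<^bsub>cochains G M (Suc n)\<^esub> power_mult (r - m) (Suc n) \<sigma>"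
  let ?s = "r - m"
  interpret C: abelian_group "cochains G M (Suc n)" by (rule cochains_abelian_group)
  interpret C': abelian_group "cochains G M (Suc (Suc n))" by (rule cochains_abelian_group)
  interpret D': abelian_group_hom "cochains G M (Suc n)" "cochains G M (Suc (Suc n))" "\<delta> (Suc n)"
    by (rule coboundary_hom)
  interpret r: G_module_hom M G act "quot_pr M N p r" "quot_pr_act M N p r act" "pro M N p r"
    by (rule pro_G_module_hom)
  interpret s: G_module_hom M G act "quot_pr M N p ?s" "quot_pr_act M N p ?s act" "pro M N p ?s"
    by (rule pro_G_module_hom)
  interpret rs: G_module_hom "quot_pr M N p r" G "quot_pr_act M N p r act"
    "quot_pr M N p ?s" "quot_pr_act M N p ?s act" "quot_proj M N p ?s"
    by (rule quot_proj_G_module_hom) simp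
  note M = sub_cochains_subset[OF \<sigma>] sub_cochains_subset[OF h]
  have f: "f \<in> carrier (cochains G M (Suc n))" using \<rho> M by (simp add: f_def)
  have df: "\<delta> (Suc n) f = power_mult r (Suc (Suc n)) h"
    using \<rho> M d\<rho> d\<sigma> coboundary_power_mult[OF M(1)] assms(1)
    by (simp add: f_def C'.add.nat_pow_pow flip: power_add)
  have "compose (tuples G (Suc n)) (quot_proj M N p ?s) (pro_cochain r (Suc n) f) = pro_cochain ?s (Suc n) f"
    using cochainsD(2)[OF f] unfolding compose_def by (intro restrict_ext) (simp add: quot_proj_pro)
  also have "\<dots> = pro_cochain ?s (Suc n) \<rho>"
    using pro_cochain_eq_iff[OF \<rho> f, of ?s] \<sigma> by (auto simp: f_def)
  finally have "coho_map G (quot_pr M N p ?s) (quot_pr_act M N p ?s act) (Suc n) (quot_proj M N p ?s)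
      (coho_class G (quot_pr M N p r) (quot_pr_act M N p r act) (Suc n) (pro_cochain r (Suc n) f))
    = coho_map G (quot_pr M N p ?s) (quot_pr_act M N p ?s act) (Suc n) (pro M N p ?s) (coho_class G M act (Suc n) \<rho>)"
    by (simp add: rs.coho_map_coho_class s.coho_map_coho_class \<rho> f r.map_cochain_closed)
  moreover have "coho_class G M act (Suc n) \<rho> \<in> carrier (cohomology G M act (Suc n))"
    using \<rho> d\<rho> by (simp add: carrier_cohomology cocycles_iff)
  ultimately show ?thesis
    using pro_coho_map_inj[of ?s n] assms(1) connecting_hom_pro[OF f h df]
    by (simp add: Phi_def f_def[symmetric] inv_into_f_f)
qed

section \<open>Representatives of all classes modulo p^r N, and their comparison\<close>

lemma pro_cochain_decompose:
  assumes "m \<le> r" and c: "c \<in> cocycles G (quot_pr M N p r) (quot_pr_act M N p r act) (Suc n)"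
  obtains \<rho> \<sigma> h where "\<rho> \<in> carrier (cochains G M (Suc n))"
    "\<delta> (Suc n) \<rho> = \<zero>\<^bsub>cochains G M (Suc (Suc n))\<^esub>" "\<sigma> \<in> CN (Suc n)" "h \<in> CN (Suc (Suc n))"
    "\<delta> (Suc (Suc n)) h = \<zero>\<^bsub>cochains G M (Suc (Suc (Suc n)))\<^esub>"
    "\<delta> (Suc n) \<sigma> = power_mult m (Suc (Suc n)) h"
    "c = pro_cochain r (Suc n) (\<rho> \<oplus>\<^bsub>cochains G M (Suc n)\<^esub> power_mult (r - m) (Suc n) \<sigma>)"
proof -
  interpret C: abelian_group "cochains G M (Suc n)" by (rule cochains_abelian_group)
  interpret C': abelian_group "cochains G M (Suc (Suc n))" by (rule cochains_abelian_group)
  interpret D': abelian_group_hom "cochains G M (Suc n)" "cochains G M (Suc (Suc n))" "\<delta> (Suc n)"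
    by (rule coboundary_hom)
  obtain f where f: "f \<in> carrier (cochains G M (Suc n))" and cf: "c = pro_cochain r (Suc n) f"
    using c pro_cochain_lift[of c r "Suc n"] unfolding cocycles_def a_kernel_def' by blast
  obtain h where h: "h \<in> CN (Suc (Suc n))" and df: "\<delta> (Suc n) f = power_mult r (Suc (Suc n)) h"
    using c f unfolding cf by (auto simp: pro_cochain_cocycle_iff)
  note dh = sub_cocycleI[OF f h df]
  obtain \<sigma> where \<sigma>: "\<sigma> \<in> CN (Suc n)" and d\<sigma>: "\<delta> (Suc n) \<sigma> = power_mult m (Suc (Suc n)) h"
    using sub_cocycle_primitive[OF h dh] .
  note M = sub_cochains_subset[OF \<sigma>] sub_cochains_subset[OF h]
  define \<rho> where "\<rho> = f \<ominus>\<^bsub>cochains G M (Suc n)\<^esub> power_mult (r - m) (Suc n) \<sigma>"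
  have \<rho>: "\<rho> \<in> carrier (cochains G M (Suc n))" using f M by (simp add: \<rho>_def)
  have f_eq: "f = \<rho> \<oplus>\<^bsub>cochains G M (Suc n)\<^esub> power_mult (r - m) (Suc n) \<sigma>"
    using f M by (simp add: \<rho>_def C.minus_eq C.a_assoc C.l_neg)
  \<comment> \<open>The two contributions p^r h and p^(r-m) p^m h cancel, as m <= r.\<close>
  have "\<delta> (Suc n) \<rho> = \<zero>\<^bsub>cochains G M (Suc (Suc n))\<^esub>"
    using f M df d\<sigma> coboundary_power_mult[OF M(1)] assms(1)
    by (simp add: \<rho>_def C.minus_eq C'.r_neg C'.add.nat_pow_pow flip: power_add)
  then show ?thesis using that \<rho> \<sigma> h dh d\<sigma> cf f_eq by blast
qed

text \<open>This contains both the independence of the choice of \<open>\<sigma>\<close> (equal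
  cocycles, different primitives) and the injectivity of \<open>Phi\<close> on classes in the form
  of \<open>Phi_pro\<close>.\<close>

lemma pro_class_unique:
  assumes r: "2 * m \<le> r" and \<rho>: "\<rho> \<in> carrier (cochains G M (Suc n))" "\<rho>' \<in> carrier (cochains G M (Suc n))"
    and \<sigma>: "\<sigma> \<in> CN (Suc n)" "\<sigma>' \<in> CN (Suc n)" and h: "h \<in> CN (Suc (Suc n))" "h' \<in> CN (Suc (Suc n))"
    and d\<sigma>: "\<delta> (Suc n) \<sigma> = power_mult m (Suc (Suc n)) h" "\<delta> (Suc n) \<sigma>' = power_mult m (Suc (Suc n)) h'"
    and c\<rho>: "coho_class G M act (Suc n) \<rho> = coho_class G M act (Suc n) \<rho>'"
    and ch: "coho_class G (sub_mod M N) act (Suc (Suc n)) h = coho_class G (sub_mod M N) act (Suc (Suc n)) h'"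
  shows "coho_class G (quot_pr M N p r) (quot_pr_act M N p r act) (Suc n)
      (pro_cochain r (Suc n) (\<rho> \<oplus>\<^bsub>cochains G M (Suc n)\<^esub> power_mult (r - m) (Suc n) \<sigma>))
    = coho_class G (quot_pr M N p r) (quot_pr_act M N p r act) (Suc n)
      (pro_cochain r (Suc n) (\<rho>' \<oplus>\<^bsub>cochains G M (Suc n)\<^esub> power_mult (r - m) (Suc n) \<sigma>'))"
proof -
  interpret C0: abelian_group "cochains G M n" by (rule cochains_abelian_group)
  interpret C: abelian_group "cochains G M (Suc n)" by (rule cochains_abelian_group)
  interpret C': abelian_group "cochains G M (Suc (Suc n))" by (rule cochains_abelian_group)
  interpret D: abelian_group_hom "cochains G M n" "cochains G M (Suc n)" "\<delta> n" by (rule coboundary_hom)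
  interpret D': abelian_group_hom "cochains G M (Suc n)" "cochains G M (Suc (Suc n))" "\<delta> (Suc n)"
    by (rule coboundary_hom)
  obtain u where u: "u \<in> carrier (cochains G M n)" "\<rho>' = \<rho> \<oplus>\<^bsub>cochains G M (Suc n)\<^esub> \<delta> n u"
    using c\<rho> \<rho> by (auto simp: coho_class_eq_iff)
  obtain w where w: "w \<in> CN (Suc n)" "h' = h \<oplus>\<^bsub>cochains G M (Suc (Suc n))\<^esub> \<delta> (Suc n) w"
    using ch h by (auto simp: sub.A.coho_class_eq_iff coboundary_sub)
  note M = \<sigma>[THEN sub_cochains_subset] h[THEN sub_cochains_subset] sub_cochains_subset[OF w(1)]
  \<comment> \<open>Since h' = h + \<open>\<delta>\<close> w, the cochain \<open>\<sigma>\<close> +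
    p^m w has the same coboundary as \<open>\<sigma>'\<close>; their difference is thus a cocycle of
    N.\<close>
  define \<tau> where "\<tau> = \<sigma>' \<ominus>\<^bsub>cochains G M (Suc n)\<^esub> (\<sigma> \<oplus>\<^bsub>cochains G M (Suc n)\<^esub> power_mult m (Suc n) w)"
  have \<tau>: "\<tau> \<in> CN (Suc n)"
  proof -
    interpret CN: abelian_group "cochains G (sub_mod M N) (Suc n)" by (rule sub.A.cochains_abelian_group)
    \<comment> \<open>Additive inverses are defined by a description over the carrier, so those for
      N and for M have to be identified through the inclusion.\<close>
    interpret I: abelian_group_hom "cochains G (sub_mod M N) (Suc n)" "cochains G M (Suc n)" "\<lambda>f. f"
      by (rule abelian_group_homI') (auto simp: CN.abelian_group_axioms C.abelian_group_axioms sub_cochains_subset)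
    have "\<ominus>\<^bsub>cochains G M (Suc n)\<^esub> x \<in> CN (Suc n)" if "x \<in> CN (Suc n)" for x
      using I.hom_a_inv[OF that] CN.a_inv_closed[OF that] by simp
    then show ?thesis
      unfolding \<tau>_def a_minus_def using \<sigma> w(1)
      by (intro sub_cochains_add_closed) (auto intro!: sub_cochains_add_closed sub_cochains_add_pow_closed)
  qed
  note \<tau>M = sub_cochains_subset[OF \<tau>]
  have \<sigma>'_eq: "\<sigma>' = \<sigma> \<oplus>\<^bsub>cochains G M (Suc n)\<^esub> power_mult m (Suc n) w \<oplus>\<^bsub>cochains G M (Suc n)\<^esub> \<tau>"
  proof -
    have "x \<oplus>\<^bsub>cochains G M (Suc n)\<^esub> (\<sigma>' \<ominus>\<^bsub>cochains G M (Suc n)\<^esub> x) = \<sigma>'"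
      if "x \<in> carrier (cochains G M (Suc n))" for x
      using that M by (simp add: C.minus_eq C.a_lcomm C.r_neg)
    then show ?thesis unfolding \<tau>_def using M by simp
  qed
  \<comment> \<open>This is where 2m <= r makes p^(r-m) \<open>\<tau>\<close> a coboundary.\<close>
  have m_le: "m \<le> r - m" using r by simp
  have "\<delta> (Suc n) \<tau> = \<zero>\<^bsub>cochains G M (Suc (Suc n))\<^esub>"
    using M d\<sigma> w(2) coboundary_power_mult[OF M(5)]
    by (simp add: \<tau>_def C.minus_eq C'.add.nat_pow_distrib C'.r_neg)
  then obtain v where v: "v \<in> CN n" "\<delta> n v = power_mult (r - m) (Suc n) \<tau>"
    by (rule sub_cocycle_power_mult_is_coboundary[OF \<tau> _ m_le])
  note vM = sub_cochains_subset[OF v(1)]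
  have "power_mult (r - m) (Suc n) \<sigma>'
      = power_mult (r - m) (Suc n) \<sigma> \<oplus>\<^bsub>cochains G M (Suc n)\<^esub> power_mult r (Suc n) w \<oplus>\<^bsub>cochains G M (Suc n)\<^esub> \<delta> n v"
    using M \<tau>M r unfolding v(2) by (subst \<sigma>'_eq) (simp add: C.add.nat_pow_distrib C.add.nat_pow_pow flip: power_add)
  \<comment> \<open>The shape required by \<open>coho_class_pro_eq_iff\<close>: the witnesses are u
    + v and w, the latter because p^(r-m) p^m w = p^r w.\<close>
  then have "\<rho>' \<oplus>\<^bsub>cochains G M (Suc n)\<^esub> power_mult (r - m) (Suc n) \<sigma>'
    = \<rho> \<oplus>\<^bsub>cochains G M (Suc n)\<^esub> power_mult (r - m) (Suc n) \<sigma> \<oplus>\<^bsub>cochains G M (Suc n)\<^esub>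
      (\<delta> n (u \<oplus>\<^bsub>cochains G M n\<^esub> v) \<oplus>\<^bsub>cochains G M (Suc n)\<^esub> power_mult r (Suc n) w)"
    using \<rho>(1) M u(1) vM unfolding u(2) by (simp add: C.a_ac)
  then show ?thesis
    using \<rho> M C0.a_closed[OF u(1) vM] w(1) by (subst coho_class_pro_eq_iff) (simp_all, blast)
qed

end

theorem proposition2p4:
  fixes G :: "('g, 'd) monoid_scheme"
    and R :: "('r, 'e) ring_scheme"
    and M :: "('r, 'a, 'c) module_scheme"
    and act :: "'g \<Rightarrow> 'a \<Rightarrow> 'a"
    and N :: "'a set"
    and p m n :: nat
    and \<rho> \<eta> :: "'g list \<Rightarrow> 'a"
  assumes "Factorial_Ring.prime p"
    and "order G = p ^ m"
    and "RG_module G R M act"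
    and "RG_submodule N G R M act"
    and "{x \<in> N. add_pow M p x = \<zero>\<^bsub>M\<^esub>} = {\<zero>\<^bsub>M\<^esub>}"
    and "n \<ge> 1"
    and "\<rho> \<in> cocycles G M act n"
    and "\<eta> \<in> cocycles G (sub_mod M N) act (n + 1)"
  shows "(\<exists>\<sigma> \<in> carrier (cochains G (sub_mod M N) n).
            coboundary G (sub_mod M N) act n \<sigma>
              = add_pow (cochains G (sub_mod M N) (n + 1)) (p ^ m) \<eta>)
    \<and> (\<forall>r \<ge> m. \<forall>\<sigma> \<in> carrier (cochains G (sub_mod M N) n).
          coboundary G (sub_mod M N) act n \<sigma>
              = add_pow (cochains G (sub_mod M N) (n + 1)) (p ^ m) \<eta>
          \<longrightarrow> compose (tuples G n) (pro M N p r)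
                (\<rho> \<oplus>\<^bsub>cochains G M n\<^esub> add_pow (cochains G M n) (p ^ (r - m)) \<sigma>)
              \<in> cocycles G (quot_pr M N p r) (quot_pr_act M N p r act) n)
    \<and> (\<forall>r \<ge> 2 * m. \<forall>\<sigma> \<in> carrier (cochains G (sub_mod M N) n).
          coboundary G (sub_mod M N) act n \<sigma>
              = add_pow (cochains G (sub_mod M N) (n + 1)) (p ^ m) \<eta>
          \<longrightarrow> (let c = coho_class G (quot_pr M N p r) (quot_pr_act M N p r act) n
                        (compose (tuples G n) (pro M N p r)
                          (\<rho> \<oplus>\<^bsub>cochains G M n\<^esub> add_pow (cochains G M n) (p ^ (r - m)) \<sigma>));
                    H = carrier (cohomology G (quot_pr M N p r) (quot_pr_act M N p r act) n);
                    y = (coho_class G M act n \<rho>, coho_class G (sub_mod M N) act (n + 1) \<eta>)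
               in c \<in> H \<and> Phi G M act N p m n r c = y
                  \<and> (\<forall>c' \<in> H. Phi G M act N p m n r c' = y \<longrightarrow> c' = c)))"
proof -
  interpret RG: RG_module G R M act by fact
  interpret RN: RG_submodule N G R M act by fact
  obtain k where n: "n = Suc k" using assms(6) by (cases n) auto
  have "p ^ m > 0" using assms(1) by (simp add: prime_gt_0_nat)
  \<comment> \<open>\<open>order\<close> is a cardinality and would be 0 for an infinite group,
    whereas p^m is positive.\<close>
  then have fin: "finite (carrier G)"
    using assms(2) card.infinite unfolding order_def by fastforce
  have "G_module M G act"
    by (intro G_module.intro G_module_axioms.intro RG.M.abelian_group_axioms RG.G.group_axioms)
      (auto simp: RG.act_closed RG.act_one RG.act_mult RG.act_add)
  then interpret p_torsion_free_submodule M G act N p m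
    using assms(2,5) fin RN.act_closed RN.subgroup_axioms
    by (intro p_torsion_free_submodule.intro p_torsion_free_submodule_axioms.intro additive_subgroupI) auto
  have \<rho>: "\<rho> \<in> carrier (cochains G M (Suc k))" "\<delta> (Suc k) \<rho> = \<zero>\<^bsub>cochains G M (Suc (Suc k))\<^esub>"
    using assms(7) by (auto simp: n cocycles_iff)
  have \<eta>: "\<eta> \<in> CN (Suc (Suc k))" "\<delta> (Suc (Suc k)) \<eta> = \<zero>\<^bsub>cochains G M (Suc (Suc (Suc k)))\<^esub>"
    using assms(8) by (auto simp: n sub.A.cocycles_iff coboundary_sub)
  \<comment> \<open>The theorem states the condition on \<open>\<sigma>\<close> inside the cochains
    of N; the lemmas use the operations of M.\<close>
  have d_iff: "coboundary G (sub_mod M N) act (Suc k) \<sigma>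
        = add_pow (cochains G (sub_mod M N) (Suc (Suc k))) (p ^ m) \<eta>
      \<longleftrightarrow> \<delta> (Suc k) \<sigma> = power_mult m (Suc (Suc k)) \<eta>" if "\<sigma> \<in> CN (Suc k)" for \<sigma>
    using that by (simp add: coboundary_sub sub_cochains_add_pow)
  let ?f = "\<lambda>r \<sigma>. \<rho> \<oplus>\<^bsub>cochains G M (Suc k)\<^esub> power_mult (r - m) (Suc k) \<sigma>"
  have 1: "\<exists>\<sigma> \<in> CN (Suc k). \<delta> (Suc k) \<sigma> = power_mult m (Suc (Suc k)) \<eta>"
    using sub_cocycle_primitive[OF \<eta>] by blast
  have 2: "pro_cochain r (Suc k) (?f r \<sigma>) \<in> cocycles G (quot_pr M N p r) (quot_pr_act M N p r act) (Suc k)"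
    if r: "m \<le> r" and \<sigma>: "\<sigma> \<in> CN (Suc k)" and d\<sigma>: "\<delta> (Suc k) \<sigma> = power_mult m (Suc (Suc k)) \<eta>" for r \<sigma>
  proof -
    interpret C: abelian_group "cochains G M (Suc k)" by (rule cochains_abelian_group)
    interpret C': abelian_group "cochains G M (Suc (Suc k))" by (rule cochains_abelian_group)
    interpret D': abelian_group_hom "cochains G M (Suc k)" "cochains G M (Suc (Suc k))" "\<delta> (Suc k)"
      by (rule coboundary_hom)
    note M = sub_cochains_subset[OF \<sigma>] sub_cochains_subset[OF \<eta>(1)]
    have "\<delta> (Suc k) (?f r \<sigma>) = power_mult r (Suc (Suc k)) \<eta>"
      using \<rho> M d\<sigma> coboundary_power_mult[OF M(1)] r
      by (simp add: C'.add.nat_pow_pow flip: power_add)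
    then show ?thesis using \<rho>(1) M \<eta>(1) by (subst pro_cochain_cocycle_iff) auto
  qed
  have 3: "c' = coho_class G (quot_pr M N p r) (quot_pr_act M N p r act) (Suc k) (pro_cochain r (Suc k) (?f r \<sigma>))"
    if r: "2 * m \<le> r" and \<sigma>: "\<sigma> \<in> CN (Suc k)" and d\<sigma>: "\<delta> (Suc k) \<sigma> = power_mult m (Suc (Suc k)) \<eta>"
      and c': "c' \<in> carrier (cohomology G (quot_pr M N p r) (quot_pr_act M N p r act) (Suc k))"
      and P: "Phi G M act N p m (Suc k) r c' = (coho_class G M act (Suc k) \<rho>, coho_class G (sub_mod M N) act (Suc (Suc k)) \<eta>)"
    for r \<sigma> c'
  proof -
    interpret pr: G_module_hom M G act "quot_pr M N p r" "quot_pr_act M N p r act" "pro M N p r"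
      by (rule pro_G_module_hom)
    obtain z where z: "z \<in> cocycles G (quot_pr M N p r) (quot_pr_act M N p r act) (Suc k)"
      and c'z: "c' = coho_class G (quot_pr M N p r) (quot_pr_act M N p r act) (Suc k) z"
      using c' by (auto simp: pr.B.carrier_cohomology)
    have "m \<le> r" using r by simp
    then obtain \<rho>' \<sigma>' h where d: "\<rho>' \<in> carrier (cochains G M (Suc k))"
      "\<delta> (Suc k) \<rho>' = \<zero>\<^bsub>cochains G M (Suc (Suc k))\<^esub>" "\<sigma>' \<in> CN (Suc k)" "h \<in> CN (Suc (Suc k))"
      "\<delta> (Suc k) \<sigma>' = power_mult m (Suc (Suc k)) h"
      "z = pro_cochain r (Suc k) (\<rho>' \<oplus>\<^bsub>cochains G M (Suc k)\<^esub> power_mult (r - m) (Suc k) \<sigma>')"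
      using pro_cochain_decompose[OF _ z] by metis
    \<comment> \<open>\<open>Phi_pro\<close> computes the image of c' from its decomposition, and
      comparison with P gives the two equalities of classes that \<open>pro_class_unique\<close>
      asks for.\<close>
    then show ?thesis
      using P Phi_pro[OF r d(1-5)] unfolding c'z d(6)
      by (intro pro_class_unique[OF r d(1) \<rho>(1) d(3) \<sigma> d(4) \<eta>(1) d(5) d\<sigma>]) auto
  qed
  have n': "n + 1 = Suc (Suc k)" using n by simp
  have H: "carrier (cohomology G (quot_pr M N p r) (quot_pr_act M N p r act) (Suc k))
      = coho_class G (quot_pr M N p r) (quot_pr_act M N p r act) (Suc k)
        ` cocycles G (quot_pr M N p r) (quot_pr_act M N p r act) (Suc k)" for r
    by (rule G_module.carrier_cohomology[OF G_module_hom.axioms(2)[OF pro_G_module_hom]])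
  show ?thesis
    unfolding n' Let_def unfolding n
  proof (intro conjI allI ballI impI)
    show "\<exists>\<sigma>\<in>CN (Suc k). coboundary G (sub_mod M N) act (Suc k) \<sigma>
        = add_pow (cochains G (sub_mod M N) (Suc (Suc k))) (p ^ m) \<eta>"
      using 1 d_iff by blast
  next
    fix r \<sigma> assume "m \<le> r" and \<sigma>: "\<sigma> \<in> CN (Suc k)"
      and "coboundary G (sub_mod M N) act (Suc k) \<sigma>
        = add_pow (cochains G (sub_mod M N) (Suc (Suc k))) (p ^ m) \<eta>"
    then show "pro_cochain r (Suc k) (?f r \<sigma>) \<in> cocycles G (quot_pr M N p r) (quot_pr_act M N p r act) (Suc k)"
      using 2 d_iff by blast
  next
    fix r \<sigma> assume r: "2 * m \<le> r" and \<sigma>: "\<sigma> \<in> CN (Suc k)"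
      and "coboundary G (sub_mod M N) act (Suc k) \<sigma>
        = add_pow (cochains G (sub_mod M N) (Suc (Suc k))) (p ^ m) \<eta>"
    then have d\<sigma>: "\<delta> (Suc k) \<sigma> = power_mult m (Suc (Suc k)) \<eta>" using d_iff by blast
    let ?c = "coho_class G (quot_pr M N p r) (quot_pr_act M N p r act) (Suc k) (pro_cochain r (Suc k) (?f r \<sigma>))"
    show "?c \<in> carrier (cohomology G (quot_pr M N p r) (quot_pr_act M N p r act) (Suc k))"
      using 2[OF _ \<sigma> d\<sigma>, of r] r by (simp add: H)
    show "Phi G M act N p m (Suc k) r ?c
        = (coho_class G M act (Suc k) \<rho>, coho_class G (sub_mod M N) act (Suc (Suc k)) \<eta>)"
      by (rule Phi_pro[OF r \<rho> \<sigma> \<eta>(1) d\<sigma>])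
    fix c' assume "c' \<in> carrier (cohomology G (quot_pr M N p r) (quot_pr_act M N p r act) (Suc k))"
      and "Phi G M act N p m (Suc k) r c'
        = (coho_class G M act (Suc k) \<rho>, coho_class G (sub_mod M N) act (Suc (Suc k)) \<eta>)"
    then show "c' = ?c" by (rule 3[OF r \<sigma> d\<sigma>])
  qed
qed

end
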